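(* Let $\lambda,\mu\in\mathbb{R}$ and let $\psi$ be a smooth solution of $D\psi=\lambda\psi+\mu|\psi|^2\psi$ on $M=\mathbb{R}^n$. Let $B_R(x_0)$ be a geodesic ball around the point $x_0\in M$ and $0<R_1<R_2\leq R$. Then $$R_2^{2-n}\mu\int_{B_{R_2}(x_0)}|\psi|^4dx-R_1^{2-n}\mu\int_{B_{R_1}(x_0)}|\psi|^4dx=-2\lambda\int_{R_1}^{R_2}\Big(r^{1-n}\int_{B_r(x_0)}|\psi|^2dx\Big)dr+2\int_{R_1}^{R_2}\Big(r^{2-n}\int_{\partial B_r(x_0)}\langle\psi,\partial_r\cdot\nabla_{\partial_r}\psi\rangle d\sigma\Big)dr.$$
   Context: $\Sigma M$ is the complex spinor bundle of $M=\mathbb{R}^n$ with the flat metric $g$, with spin connection $\nabla$ and hermitian metric; $\langle\cdot,\cdot\rangle$ denotes its real part and $|\cdot|$ the pointwise norm. Clifford multiplication is skew-symmetric and satisfies $X\cdot Y+Y\cdot X=-2g(X,Y)$. The Dirac operator is $D=\sum_i e_i\cdot\nabla_{e_i}$ for an orthonormal frame $e_i$. Here $r$ is the distance to $x_0$, $\partial_r$ the unit radial vector field from $x_0$, and $d\sigma$ the induced measure on the sphere $\partial B_r(x_0)$. *)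

theory Defs
  imports "HOL-Analysis.Analysis"
begin

text \<open>
  The spinor bundle of flat \<open>\<real>\<^sup>n\<close> is trivialised by parallel sections: its fibre is the
  complex spinor module, here \<^typ>\<open>complex^'s\<close>, and the spin connection is the ordinary
  directional derivative.  The standard hermitian product on \<^typ>\<open>complex^'s\<close> has the library's
  \<^term>\<open>(\<bullet>)\<close> as its real part and the library's norm as its norm.
\<close>

text \<open>
  Clifford multiplication by \<open>X\<close> is the complex matrix \<open>c X\<close>.  A complex representation of
  the Clifford algebra of \<open>\<real>\<^sup>n\<close> of dimension \<open>2\<^bsup>\<lfloor>n/2\<rfloor>\<^esup>\<close> is automatically irreducible, so the
  last clause says that the representation is the spinor representation (either of the two
  inequivalent ones if \<open>n\<close> is odd).
\<close>

definition spinor_clifford_mult :: "(real^'n \<Rightarrow> complex^'s^'s) \<Rightarrow> bool" where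
  "spinor_clifford_mult c \<longleftrightarrow>
     linear c \<and>
     (\<forall>X Y. c X ** c Y + c Y ** c X = (- 2 * (X \<bullet> Y)) *\<^sub>R mat 1) \<and>
     (\<forall>X \<phi> \<psi>. (c X *v \<phi>) \<bullet> \<psi> = - (\<phi> \<bullet> (c X *v \<psi>))) \<and>
     CARD('s) = 2 ^ (CARD('n) div 2)"

definition nabla :: "real^'n \<Rightarrow> (real^'n \<Rightarrow> complex^'s) \<Rightarrow> real^'n \<Rightarrow> complex^'s" where
  "nabla X \<psi> x = frechet_derivative \<psi> (at x) X"

definition Dirac ::
  "(real^'n \<Rightarrow> complex^'s^'s) \<Rightarrow> (real^'n \<Rightarrow> complex^'s) \<Rightarrow> real^'n \<Rightarrow> complex^'s" where
  "Dirac c \<psi> x = (\<Sum>e\<in>Basis. c e *v nabla e \<psi> x)"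

primrec C_diff :: "nat \<Rightarrow> ('a::real_normed_vector \<Rightarrow> 'b::real_normed_vector) \<Rightarrow> bool" where
  "C_diff 0 f \<longleftrightarrow> continuous_on UNIV f"
| "C_diff (Suc k) f \<longleftrightarrow>
     f differentiable_on UNIV \<and> (\<forall>v. C_diff k (\<lambda>x. frechet_derivative f (at x) v))"

definition smooth :: "('a::real_normed_vector \<Rightarrow> 'b::real_normed_vector) \<Rightarrow> bool" where
  "smooth f \<longleftrightarrow> (\<forall>k. C_diff k f)"

definition radial_field :: "real^'n \<Rightarrow> real^'n \<Rightarrow> real^'n" where
  "radial_field x0 x = (x - x0) /\<^sub>R dist x x0"

text \<open>
  The measure induced by the flat metric on the graph \<open>{x. x\<^sub>k = h(x\<^sub>j : j \<noteq> k)}\<close> over an open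
  set \<open>U\<close>: in the chart \<open>y = (x\<^sub>j : j \<noteq> k)\<close> the induced metric is \<open>I + \<nabla>h \<nabla>h\<^sup>T\<close>, whose
  determinant is \<open>1 + |\<nabla>h|\<^sup>2\<close>.
\<close>

definition graph_measure ::
  "'n \<Rightarrow> ('n \<Rightarrow> real) set \<Rightarrow> (('n \<Rightarrow> real) \<Rightarrow> real) \<Rightarrow> (real^'n) measure" where
  "graph_measure k U h =
     distr
       (density (\<Pi>\<^sub>M j\<in>- {k}. lborel)
          (\<lambda>y. ennreal (indicator U y *
             sqrt (1 + (\<Sum>j\<in>- {k}. (deriv (\<lambda>t. h (y(j := t))) (y j))\<^sup>2)))))
       borel
       (\<lambda>y. \<chi> j. if j = k then h y else y j)"

text \<open>
  The sphere of radius \<open>r\<close> about \<open>x0\<close> is, up to the null set \<open>x\<^sub>k = x0\<^sub>k\<close>, the disjoint union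
  of the two graphs \<open>x\<^sub>k = x0\<^sub>k \<plusminus> sqrt (r\<^sup>2 - \<Sum>\<^bsub>j\<noteq>k\<^esub> (x\<^sub>j - x0\<^sub>j)\<^sup>2)\<close>.  The resulting measure,
  taken on the ambient space and carried by the sphere, does not depend on the coordinate \<open>k\<close>
  used.  For \<open>n = 1\<close> it is the counting measure on the two points \<open>x0 \<plusminus> r\<close>.
\<close>

definition sphere_measure :: "real^'n \<Rightarrow> real \<Rightarrow> (real^'n) measure" where
  "sphere_measure x0 r =
     (let k = (SOME k. True);
          q = (\<lambda>y. \<Sum>j\<in>- {k}. (y j - x0 $ j)\<^sup>2);
          U = {y. q y < r\<^sup>2};
          upper = graph_measure k U (\<lambda>y. x0 $ k + sqrt (r\<^sup>2 - q y));
          lower = graph_measure k U (\<lambda>y. x0 $ k - sqrt (r\<^sup>2 - q y))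
      in measure_of UNIV (sets borel) (\<lambda>A. emeasure upper A + emeasure lower A))"

end

theory Submission
  imports Defs
begin

text \<open>
  The formula is the integrated form of the conservation law of the energy-momentum tensor
  \<open>T(X, Y) = \<langle>\<psi>, X \<cdot> \<nabla>\<^sub>Y \<psi>\<rangle> - g(X, Y) \<mu>/2 |\<psi>|^4\<close>, whose second term is the Lagrangian evaluated on a
  solution.  The divergence of \<open>T\<close> in its first slot vanishes: Clifford multiplication is
  skew-symmetric, second derivatives commute, and the equation can be differentiated.  Hence the
  vector field \<open>S = T(\<cdot>, x - x0)\<close> has divergence
  \<open>tr T = \<lambda> |\<psi>|^2 + \<mu> (1 - n/2) |\<psi>|^4\<close> (\<open>momentum_current_divergence\<close>), while its radial component at
  distance \<open>\<rho>\<close> from \<open>x0\<close> is \<open>\<rho> (\<langle>\<psi>, \<partial>\<^sub>r \<cdot> \<nabla>\<^sub>r \<psi>\<rangle> - \<mu>/2 |\<psi>|^4)\<close> (\<open>momentum_current_radial\<close>).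

  The textbook argument applies the divergence theorem on each ball \<open>B\<^sub>r\<close> and integrates
  \<open>r^(1 - n)\<close> times the result over \<open>[R1, R2]\<close>.  Exchanging the order of integration turns this into
  a single identity on the whole space.  Let \<open>\<eta>(x) = \<integral> s^(1 - n) ds\<close>, integrated from
  \<open>max R1 |x - x0|\<close> to \<open>R2\<close>, and \<open>\<eta> = 0\<close> outside \<open>B\<^sub>R\<^sub>2\<close>.  This function is Lipschitz with compact
  support, and integrals of directional derivatives of such functions vanish, so
  \<open>\<integral> div (\<eta> S) = 0\<close> (\<open>integral_cutoff_divergence\<close>).  As \<open>\<eta>\<close> is a superposition of indicator functions
  of balls, \<open>\<integral> \<eta> div S\<close> is the integral over \<open>[R1, R2]\<close> of \<open>s^(1 - n) \<integral>\<^sub>B\<^sub>s div S\<close>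
  (\<open>integral_radial_cutoff\<close>), and \<open>\<integral> \<nabla>\<eta> \<cdot> S\<close> is an integral over the annulus.

  Two rewritings finish the proof.  The annulus integral of \<open>\<rho>^(2 - n) \<langle>\<psi>, \<partial>\<^sub>r \<cdot> \<nabla>\<^sub>r \<psi>\<rangle>\<close> becomes an
  iterated integral over spheres by polar integration (\<open>integral_annulus_polar\<close>).  The terms in
  \<open>|\<psi>|^4\<close> combine into the boundary terms by applying \<open>integral_radial_cutoff\<close> a second time, now to
  the function \<open>s^(2 - n)\<close> and its derivative, which is integration by parts in \<open>s\<close>.

  Polar integration for the graph measure on spheres comes from Fubini's theorem: for a fixed point
  \<open>y\<close> of the coordinate hyperplane at squared distance \<open>q\<close> from the centre, the density
  \<open>r / sqrt (r^2 - q)\<close> of the graph measure is exactly the derivative of the height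
  \<open>z = sqrt (r^2 - q)\<close> in \<open>r\<close>, so integrating over \<open>r\<close> is integrating over the vertical half-line.
\<close>

section \<open>Splitting off one coordinate\<close>

definition insert_coord :: "'n \<Rightarrow> ('n \<Rightarrow> real) \<Rightarrow> real \<Rightarrow> real^'n" where
  "insert_coord k y t = (\<chi> j. if j = k then t else y j)"

lemma insert_coord_nth [simp]: "insert_coord k y t $ j = (if j = k then t else y j)"
  by (simp add: insert_coord_def)

abbreviation other_coords :: "'n::finite \<Rightarrow> ('n \<Rightarrow> real) measure" where
  "other_coords k \<equiv> \<Pi>\<^sub>M j\<in>- {k}. lborel"

interpretation lborel_product: product_sigma_finite "\<lambda>_. lborel :: real measure"
  by standard

lemma sigma_finite_other_coords: "sigma_finite_measure (other_coords k)"
  by (intro lborel_product.sigma_finite) simp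

lemma measurable_insert_coord [measurable]:
  assumes [measurable]: "f \<in> M \<rightarrow>\<^sub>M other_coords k" "g \<in> borel_measurable M"
  shows "(\<lambda>x. insert_coord k (f x) (g x)) \<in> borel_measurable M"
proof -
  have "(\<lambda>x. insert_coord k (f x) (g x) $ j) \<in> borel_measurable M" for j
    using measurable_compose[OF assms(1) measurable_component_singleton, of j] assms(2)
    by (cases "j = k") auto
  then have "(\<lambda>x. insert_coord k (f x) (g x) \<bullet> axis j 1) \<in> borel_measurable M" for j
    by (simp add: inner_axis)
  then show ?thesis
    unfolding borel_measurable_euclidean_space[where f="\<lambda>x. insert_coord k (f x) (g x)"] Basis_vec_def
    by simp
qed

lemma prod_Basis_vec: "(\<Prod>b\<in>(Basis :: (real^'n) set). F b) = (\<Prod>j\<in>UNIV. F (axis j 1))"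
  unfolding Basis_vec_def
  by (simp add: axis_eq_axis inj_on_def prod.UNION_disjoint image_def[symmetric])

text \<open>
  Both sides give a box the product of its side lengths, and boxes determine Lebesgue measure.
\<close>

lemma lborel_eq_distr_insert_coord:
  fixes k :: "'n::finite"
  shows "(lborel :: (real^'n) measure) =
    distr (other_coords k \<Otimes>\<^sub>M lborel) borel (\<lambda>p. insert_coord k (fst p) (snd p))"
proof (rule lborel_eqI)
  fix l u :: "real^'n" assume "\<And>b. b \<in> Basis \<Longrightarrow> l \<bullet> b \<le> u \<bullet> b"
  then have "l \<bullet> axis j 1 \<le> u \<bullet> axis j 1" for j by simp
  then have le: "l $ j \<le> u $ j" for j
    by (simp add: inner_axis)
  let ?A = "\<Pi>\<^sub>E j\<in>- {k}. {l $ j<..<u $ j}"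
  have eq: "(\<lambda>p. insert_coord k (fst p) (snd p)) -` box l u \<inter> space (other_coords k \<Otimes>\<^sub>M lborel)
      = ?A \<times> {l $ k<..<u $ k}"
    (is "?L = _")
  proof (intro set_eqI)
    fix p :: "('n \<Rightarrow> real) \<times> real"
    obtain y t where p: "p = (y, t)" by fastforce
    have "p \<in> ?L \<longleftrightarrow> (\<forall>j. l $ j < (if j = k then t else y j) \<and> (if j = k then t else y j) < u $ j)
        \<and> y \<in> extensional (- {k})"
      by (simp add: p mem_box_cart space_pair_measure space_PiM PiE_def Pi_def)
    also have "\<dots> \<longleftrightarrow> p \<in> ?A \<times> {l $ k<..<u $ k}"
      unfolding p by (auto simp: PiE_def Pi_def split: if_splits)
    finally show "p \<in> ?L \<longleftrightarrow> p \<in> ?A \<times> {l $ k<..<u $ k}" .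
  qed
  have "emeasure (distr (other_coords k \<Otimes>\<^sub>M lborel) borel (\<lambda>p. insert_coord k (fst p) (snd p))) (box l u)
      = emeasure (other_coords k \<Otimes>\<^sub>M lborel) (?A \<times> {l $ k<..<u $ k})"
    by (subst emeasure_distr) (auto simp: eq)
  also have "\<dots> = emeasure (other_coords k) ?A * emeasure lborel {l $ k<..<u $ k}"
    by (intro lborel.emeasure_pair_measure_Times sets_PiM_I_finite) auto
  also have "\<dots> = (\<Prod>j\<in>- {k}. ennreal (u $ j - l $ j)) * ennreal (u $ k - l $ k)"
    by (subst lborel_product.emeasure_PiM) (auto simp: le)
  also have "\<dots> = (\<Prod>j\<in>UNIV. ennreal (u $ j - l $ j))"
    by (subst prod.remove[of UNIV k]) (simp_all add: Compl_eq_Diff_UNIV[symmetric] mult.commute)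
  also have "\<dots> = ennreal (\<Prod>b\<in>Basis. (u - l) \<bullet> b)"
    by (simp add: prod_Basis_vec inner_axis prod_ennreal le)
  finally show "emeasure (distr (other_coords k \<Otimes>\<^sub>M lborel) borel (\<lambda>p. insert_coord k (fst p) (snd p))) (box l u)
      = (\<Prod>b\<in>Basis. (u - l) \<bullet> b)" .
qed simp

lemma nn_integral_lborel_insert_coord:
  fixes k :: "'n::finite" and f :: "real^'n \<Rightarrow> ennreal"
  assumes [measurable]: "f \<in> borel_measurable borel"
  shows "(\<integral>\<^sup>+ x. f x \<partial>lborel) = (\<integral>\<^sup>+ y. \<integral>\<^sup>+ t. f (insert_coord k y t) \<partial>lborel \<partial>other_coords k)"
proof -
  have "(\<integral>\<^sup>+ x. f x \<partial>lborel)
      = (\<integral>\<^sup>+ p. f (insert_coord k (fst p) (snd p)) \<partial>(other_coords k \<Otimes>\<^sub>M lborel))"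
    by (subst lborel_eq_distr_insert_coord[of k]) (rule nn_integral_distr; measurable)
  also have "\<dots> = (\<integral>\<^sup>+ y. \<integral>\<^sup>+ t. f (insert_coord k y t) \<partial>lborel \<partial>other_coords k)"
    by (subst lborel.nn_integral_fst[symmetric]) auto
  finally show ?thesis .
qed

section \<open>Polar integration over hemispheres\<close>

text \<open>
  The substitution \<open>z = sqrt (r^2 - q)\<close>.  Its derivative blows up as \<open>r\<close> tends to \<open>sqrt q\<close>, so the
  substitution rule for compact intervals is applied for \<open>z\<close> in \<open>[1/(m+1), m+2]\<close>, and the intervals
  exhaust the half-line as \<open>m\<close> grows.
\<close>

lemma nn_integral_half_line_substitution:
  fixes q :: real and g :: "real \<Rightarrow> ennreal"
  assumes [measurable]: "g \<in> borel_measurable borel" and q: "0 \<le> q"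
  shows "(\<integral>\<^sup>+ r. g (sqrt (r\<^sup>2 - q)) * ennreal (r / sqrt (r\<^sup>2 - q)) * indicator {sqrt q<..} r \<partial>lborel)
       = (\<integral>\<^sup>+ z. g z * indicator {0<..} z \<partial>lborel)" (is "(\<integral>\<^sup>+ r. ?f r * _ \<partial>_) = _")
proof -
  define lo hi where "lo m = 1 / real (Suc m)" and "hi m = real (m + 2)" for m
  \<comment> \<open>the inverse of the substitution, carrying \<open>[lo m, hi m]\<close> to the corresponding interval of radii\<close>
  define s where "s z = sqrt (z\<^sup>2 + q)" for z
  have lo: "0 < lo m" "lo m < hi m" for m
  proof -
    have "lo m \<le> 1" "1 < hi m" by (auto simp: lo_def hi_def field_simps)
    then show "lo m < hi m" by linarith
  qed (simp add: lo_def)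
  have s_less: "sqrt q < s (lo m)" "s (lo m) < s (hi m)" for m
    using lo[of m] q by (auto simp: s_def intro!: power_strict_mono)
  have s_mono: "s a \<le> s b" if "0 \<le> a" "a \<le> b" for a b
    using that by (auto simp: s_def intro!: power_mono)
  have s_inv: "sqrt ((s z)\<^sup>2 - q) = z" if "0 \<le> z" for z
    using that q by (simp add: s_def)
  have step: "(\<integral>\<^sup>+ z. g z * indicator {lo m..hi m} z \<partial>lborel)
      = (\<integral>\<^sup>+ r. ?f r * indicator {s (lo m)..s (hi m)} r \<partial>lborel)" for m
  proof -
    have pos: "0 < r\<^sup>2 - q" "0 < r" if "r \<in> {s (lo m)..s (hi m)}" for r
    proof -
      have "sqrt q < r" using s_less[of m] that by auto
      moreover have "0 \<le> sqrt q" using q by simp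
      ultimately show "0 < r" by linarith
      have "(sqrt q)\<^sup>2 < r\<^sup>2" using \<open>sqrt q < r\<close> \<open>0 \<le> sqrt q\<close> by (intro power_strict_mono) auto
      then show "0 < r\<^sup>2 - q" using q by simp
    qed
    have "(\<integral>\<^sup>+ z. g z * indicator {sqrt ((s (lo m))\<^sup>2 - q)..sqrt ((s (hi m))\<^sup>2 - q)} z \<partial>lborel)
      = (\<integral>\<^sup>+ r. g (sqrt (r\<^sup>2 - q)) * ennreal (r / sqrt (r\<^sup>2 - q)) * indicator {s (lo m)..s (hi m)} r \<partial>lborel)"
    proof (rule nn_integral_substitution_aux)
      fix r assume r: "r \<in> {s (lo m)..s (hi m)}"
      show "((\<lambda>r. sqrt (r\<^sup>2 - q)) has_real_derivative r / sqrt (r\<^sup>2 - q)) (at r)"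
        using pos[OF r] by (auto intro!: derivative_eq_intros simp: field_simps)
      show "0 \<le> r / sqrt (r\<^sup>2 - q)"
        using pos[OF r] by simp
    next
      show "continuous_on {s (lo m)..s (hi m)} (\<lambda>r. r / sqrt (r\<^sup>2 - q))"
        using pos by (intro continuous_intros) (force simp: less_imp_neq[symmetric])
    qed (use s_less[of m] in auto)
    then show ?thesis using lo[of m] by (simp add: s_inv less_imp_le)
  qed
  have lo_dec: "lo (Suc m) \<le> lo m" "hi m \<le> hi (Suc m)" for m
    unfolding lo_def hi_def by (intro divide_left_mono) auto
  have UN1: "(\<Union>m. {lo m..hi m}) = {0<..}"
  proof safe
    fix z :: real assume "0 < z"
    obtain m1 where m1: "1 / real (Suc m1) < z" using nat_approx_posE[OF \<open>0 < z\<close>] by blast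
    obtain m2 where m2: "z < real m2" using reals_Archimedean2 by blast
    let ?m = "max m1 m2"
    have "lo ?m \<le> lo m1" unfolding lo_def by (intro divide_left_mono) auto
    moreover have "real m2 \<le> hi ?m" by (auto simp: hi_def)
    ultimately show "z \<in> (\<Union>m. {lo m..hi m})" using m1 m2 by (intro UN_I[of ?m]) (auto simp: lo_def)
  qed (use lo in \<open>auto intro: less_le_trans\<close>)
  have UN2: "(\<Union>m. {s (lo m)..s (hi m)}) = {sqrt q<..}"
  proof safe
    fix r assume r: "sqrt q < r"
    have "0 \<le> sqrt q" using q by simp
    then have "(sqrt q)\<^sup>2 < r\<^sup>2" using r by (intro power_strict_mono) auto
    then have "0 < sqrt (r\<^sup>2 - q)" using q by simp
    then have "sqrt (r\<^sup>2 - q) \<in> (\<Union>m. {lo m..hi m})" unfolding UN1 by (rule greaterThan_iff[THEN iffD2])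
    then obtain m where m: "lo m \<le> sqrt (r\<^sup>2 - q)" "sqrt (r\<^sup>2 - q) \<le> hi m"
      unfolding UN_iff atLeastAtMost_iff by blast
    have "0 < r" using r \<open>0 \<le> sqrt q\<close> by linarith
    have "(sqrt (r\<^sup>2 - q))\<^sup>2 + q = r\<^sup>2" using \<open>(sqrt q)\<^sup>2 < r\<^sup>2\<close> q by simp
    then have "s (sqrt (r\<^sup>2 - q)) = r" unfolding s_def using \<open>0 < r\<close> by (metis abs_of_pos real_sqrt_abs)
    moreover have "s (lo m) \<le> s (sqrt (r\<^sup>2 - q))" "s (sqrt (r\<^sup>2 - q)) \<le> s (hi m)"
      using m lo[of m] \<open>(sqrt q)\<^sup>2 < r\<^sup>2\<close> q by (auto intro!: s_mono)
    ultimately show "r \<in> (\<Union>m. {s (lo m)..s (hi m)})" by auto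
  qed (use s_less in \<open>auto intro: less_le_trans\<close>)
  have inc1: "incseq (\<lambda>m. {lo m..hi m})"
    using lo_dec by (intro incseq_SucI) (auto intro: order_trans)
  have inc2: "incseq (\<lambda>m. {s (lo m)..s (hi m)})"
  proof (intro incseq_SucI)
    fix m show "{s (lo m)..s (hi m)} \<le> {s (lo (Suc m))..s (hi (Suc m))}"
      using s_mono[of "lo (Suc m)" "lo m"] s_mono[of "hi m" "hi (Suc m)"] lo[of "Suc m"] lo_dec[of m]
      by (auto simp: hi_def)
  qed
  have SUP1: "(SUP m. \<integral>\<^sup>+ z. G z * indicator (A m) z \<partial>lborel) = (\<integral>\<^sup>+ z. G z * indicator (\<Union>m. A m) z \<partial>lborel)"
    if "incseq A" "\<And>m. A m \<in> sets borel" and [measurable]: "G \<in> borel_measurable borel"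
    for A :: "nat \<Rightarrow> real set" and G
    using SUP_emeasure_incseq[of A "density lborel G"] that
    by (simp add: emeasure_density image_subset_iff sets.countable_UN)
  show ?thesis
    using SUP1[OF inc1, of g] SUP1[OF inc2, of ?f] by (simp add: UN1 UN2 step)
qed

text \<open>
  The squared distance of a point of the hyperplane with normal \<open>k\<close> from the projection of \<open>x0\<close>.  The
  sphere of radius \<open>r\<close> lies over the points where it is at most \<open>r^2\<close>.
\<close>

definition plane_dist2 :: "real^'n \<Rightarrow> 'n \<Rightarrow> ('n \<Rightarrow> real) \<Rightarrow> real" where
  "plane_dist2 x0 k y = (\<Sum>j\<in>- {k}. (y j - x0 $ j)\<^sup>2)"

text \<open>
  The factor \<open>sqrt (1 + |\<nabla>h|^2)\<close> of the graph measure, in closed form, for the height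
  \<open>h = sqrt (r^2 - q)\<close>.  Radii \<open>r \<le> 0\<close> get density 0, which makes integrals over all real \<open>r\<close> range over
  the spheres of positive radius only.
\<close>

definition hemisphere_density :: "real^'n \<Rightarrow> 'n \<Rightarrow> real \<Rightarrow> ('n \<Rightarrow> real) \<Rightarrow> real" where
  "hemisphere_density x0 k r y =
    (if 0 < r \<and> plane_dist2 x0 k y < r\<^sup>2 then r / sqrt (r\<^sup>2 - plane_dist2 x0 k y) else 0)"

definition hemisphere_point :: "real^'n \<Rightarrow> 'n \<Rightarrow> real \<Rightarrow> real \<Rightarrow> ('n \<Rightarrow> real) \<Rightarrow> real^'n" where
  "hemisphere_point x0 k s r y = insert_coord k y (x0 $ k + s * sqrt (r\<^sup>2 - plane_dist2 x0 k y))"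

definition hemisphere_measure :: "real^'n \<Rightarrow> 'n \<Rightarrow> real \<Rightarrow> real \<Rightarrow> (real^'n) measure" where
  "hemisphere_measure x0 k s r =
    distr (density (other_coords k) (\<lambda>y. ennreal (hemisphere_density x0 k r y))) borel
      (hemisphere_point x0 k s r)"

lemma plane_dist2_nonneg: "0 \<le> plane_dist2 x0 k y"
  by (simp add: plane_dist2_def sum_nonneg)

lemma hemisphere_density_nonneg: "0 \<le> hemisphere_density x0 k r y"
  by (simp add: hemisphere_density_def)

lemma measurable_plane_dist2 [measurable]:
  assumes "f \<in> M \<rightarrow>\<^sub>M other_coords k"
  shows "(\<lambda>x. plane_dist2 x0 k (f x)) \<in> borel_measurable M"
proof -
  have "(\<lambda>x. f x j) \<in> borel_measurable M" if "j \<in> - {k}" for j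
    using measurable_compose[OF assms measurable_component_singleton[OF that]] by simp
  then show ?thesis
    unfolding plane_dist2_def by (intro borel_measurable_sum) auto
qed

lemma measurable_hemisphere_density [measurable]:
  assumes [measurable]: "f \<in> borel_measurable M" "g \<in> M \<rightarrow>\<^sub>M other_coords k"
  shows "(\<lambda>x. hemisphere_density x0 k (f x) (g x)) \<in> borel_measurable M"
  unfolding hemisphere_density_def by measurable

lemma measurable_hemisphere_point [measurable]:
  assumes [measurable]: "f \<in> borel_measurable M" "g \<in> M \<rightarrow>\<^sub>M other_coords k"
  shows "(\<lambda>x. hemisphere_point x0 k s (f x) (g x)) \<in> borel_measurable M"
  unfolding hemisphere_point_def by measurable

lemma dist_insert_coord_sq:
  "(dist (insert_coord k y t) x0)\<^sup>2 = (t - x0 $ k)\<^sup>2 + plane_dist2 x0 k y"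
proof -
  have "(dist (insert_coord k y t) x0)\<^sup>2 = (\<Sum>j\<in>UNIV. ((if j = k then t else y j) - x0 $ j)\<^sup>2)"
    by (simp add: dist_vec_def L2_set_def sum_nonneg dist_real_def)
  also have "\<dots> = (t - x0 $ k)\<^sup>2 + (\<Sum>j\<in>UNIV - {k}. ((if j = k then t else y j) - x0 $ j)\<^sup>2)"
    by (subst sum.remove[of UNIV k]) auto
  also have "\<dots> = (t - x0 $ k)\<^sup>2 + plane_dist2 x0 k y"
    unfolding plane_dist2_def Compl_eq_Diff_UNIV by (intro arg_cong2[of _ _ _ _ "(+)"] sum.cong) auto
  finally show ?thesis .
qed

lemma dist_hemisphere_point:
  assumes "s \<in> {1, -1}" "0 < r" "plane_dist2 x0 k y < r\<^sup>2"
  shows "dist (hemisphere_point x0 k s r y) x0 = r"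
proof -
  have "(dist (hemisphere_point x0 k s r y) x0)\<^sup>2 = r\<^sup>2"
    unfolding hemisphere_point_def dist_insert_coord_sq using assms by (auto simp: power_mult_distrib)
  then show ?thesis using assms by (simp add: power2_eq_iff_nonneg)
qed

lemma nn_integral_hemisphere_measure:
  assumes [measurable]: "F \<in> borel_measurable borel"
  shows "(\<integral>\<^sup>+ x. F x \<partial>hemisphere_measure x0 k s r)
    = (\<integral>\<^sup>+ y. ennreal (hemisphere_density x0 k r y) * F (hemisphere_point x0 k s r y) \<partial>other_coords k)"
  unfolding hemisphere_measure_def
  by (subst nn_integral_distr) (auto intro!: nn_integral_density)

text \<open>
  Polar integration on the half-space above (\<open>s = 1\<close>) or below (\<open>s = - 1\<close>) the centre.  After the
  integrals are exchanged, the inner one runs over radii for a fixed point of the hyperplane, and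
  \<open>nn_integral_half_line_substitution\<close> converts it to the integral over a vertical half-line.
\<close>

lemma nn_integral_hemispheres:
  fixes F :: "real^'n \<Rightarrow> ennreal"
  assumes [measurable]: "F \<in> borel_measurable borel" and s: "s \<in> {1, -1}"
  shows "(\<integral>\<^sup>+ r. \<integral>\<^sup>+ y. ennreal (hemisphere_density x0 k r y) * F (hemisphere_point x0 k s r y)
            \<partial>other_coords k \<partial>lborel)
       = (\<integral>\<^sup>+ x. F x * indicator {x. 0 < s * (x $ k - x0 $ k)} x \<partial>lborel)"
proof -
  interpret pair_sigma_finite "lborel :: real measure" "other_coords k"
    using sigma_finite_lborel sigma_finite_other_coords by (rule pair_sigma_finite.intro)
  let ?q = "plane_dist2 x0 k"
  have "(\<integral>\<^sup>+ r. \<integral>\<^sup>+ y. ennreal (hemisphere_density x0 k r y) * F (hemisphere_point x0 k s r y)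
            \<partial>other_coords k \<partial>lborel)
      = (\<integral>\<^sup>+ y. \<integral>\<^sup>+ r. ennreal (hemisphere_density x0 k r y) * F (hemisphere_point x0 k s r y)
            \<partial>lborel \<partial>other_coords k)"
    by (rule Fubini'[symmetric]) measurable
  also have "\<dots> = (\<integral>\<^sup>+ y. \<integral>\<^sup>+ t. F (insert_coord k y t) * indicator {t. 0 < s * (t - x0 $ k)} t
            \<partial>lborel \<partial>other_coords k)"
  proof (rule nn_integral_cong)
    fix y :: "'n \<Rightarrow> real" assume [measurable]: "y \<in> space (other_coords k)"
    define G where "G z = F (insert_coord k y (x0 $ k + s * z))" for z
    have [measurable]: "G \<in> borel_measurable borel" unfolding G_def by measurable
    have less_iff: "(0 < r \<and> ?q y < r\<^sup>2) = (sqrt (?q y) < r)" for r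
      using plane_dist2_nonneg[of x0 k y] real_sqrt_less_iff[of "?q y" "r\<^sup>2"]
      by (smt (verit, best) real_sqrt_abs real_sqrt_ge_zero)
    have "(\<integral>\<^sup>+ r. ennreal (hemisphere_density x0 k r y) * F (hemisphere_point x0 k s r y) \<partial>lborel)
        = (\<integral>\<^sup>+ r. G (sqrt (r\<^sup>2 - ?q y)) * ennreal (r / sqrt (r\<^sup>2 - ?q y)) * indicator {sqrt (?q y)<..} r \<partial>lborel)"
      by (intro nn_integral_cong)
         (auto simp: hemisphere_density_def hemisphere_point_def G_def less_iff mult.commute split: split_indicator)
    also have "\<dots> = (\<integral>\<^sup>+ z. G z * indicator {0<..} z \<partial>lborel)"
      by (rule nn_integral_half_line_substitution) (auto simp: plane_dist2_nonneg)
    also have "\<dots> = (\<integral>\<^sup>+ t. F (insert_coord k y t) * indicator {t. 0 < s * (t - x0 $ k)} t \<partial>lborel)"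
      using s by (subst (2) nn_integral_real_affine[where c = s and t = "x0 $ k"])
        (auto simp: G_def intro!: nn_integral_cong split: split_indicator)
    finally show "(\<integral>\<^sup>+ r. ennreal (hemisphere_density x0 k r y) * F (hemisphere_point x0 k s r y) \<partial>lborel)
        = (\<integral>\<^sup>+ t. F (insert_coord k y t) * indicator {t. 0 < s * (t - x0 $ k)} t \<partial>lborel)" .
  qed
  also have "\<dots> = (\<integral>\<^sup>+ x. F x * indicator {x. 0 < s * (x $ k - x0 $ k)} x \<partial>lborel)"
    by (subst nn_integral_lborel_insert_coord[of _ k])
       (auto intro!: nn_integral_cong split: split_indicator)
  finally show ?thesis .
qed

text \<open>
  Signed integrands need more than monotone identities: the image of the weighted product measure
  under the polar parametrisation is Lebesgue measure on the half-space, so integrability transfers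
  and Fubini's theorem applies.  The integral over an individual hemisphere may fail to exist for a
  null set of radii.
\<close>

lemma
  fixes F :: "real^'n \<Rightarrow> real"
  assumes F: "integrable lborel F" and s: "s \<in> {1, -1}"
  shows AE_integrable_hemisphere: "AE r in lborel. 0 < r \<longrightarrow> integrable (hemisphere_measure x0 k s r) F"
    and integrable_hemisphere_integrals:
      "integrable lborel (\<lambda>r. indicator {0<..} r * (\<integral> x. F x \<partial>hemisphere_measure x0 k s r))"
    and integral_hemispheres:
      "(\<integral> r. indicator {0<..} r * (\<integral> x. F x \<partial>hemisphere_measure x0 k s r) \<partial>lborel)
        = (\<integral> x. indicator {x. 0 < s * (x $ k - x0 $ k)} x * F x \<partial>lborel)"
proof -
  interpret pair_sigma_finite "lborel :: real measure" "other_coords k"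
    using sigma_finite_lborel sigma_finite_other_coords by (rule pair_sigma_finite.intro)
  let ?H = "{x. 0 < s * (x $ k - x0 $ k)}"
  define w where "w p = hemisphere_density x0 k (fst p) (snd p)" for p
  define \<Phi> where "\<Phi> p = hemisphere_point x0 k s (fst p) (snd p)" for p
  have [measurable]: "F \<in> borel_measurable borel" using F by auto
  have [measurable]: "?H \<in> sets borel" by measurable
  have [measurable]: "w \<in> borel_measurable (lborel \<Otimes>\<^sub>M other_coords k)"
    unfolding w_def by measurable
  have [measurable]: "\<Phi> \<in> borel_measurable (lborel \<Otimes>\<^sub>M other_coords k)"
    unfolding \<Phi>_def by measurable
  have w_nonneg: "0 \<le> w p" for p
    by (simp add: w_def hemisphere_density_nonneg)
  have eq: "distr (density (lborel \<Otimes>\<^sub>M other_coords k) (\<lambda>p. ennreal (w p))) borel \<Phi>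
      = density lborel (\<lambda>x. ennreal (indicator ?H x))" (is "?D = ?L")
  proof (rule measure_eqI)
    fix A assume "A \<in> sets ?D"
    then have [measurable]: "A \<in> sets borel" by simp
    have "emeasure ?D A = (\<integral>\<^sup>+ x. indicator A x \<partial>?D)" by simp
    also have "\<dots> = (\<integral>\<^sup>+ p. ennreal (w p) * indicator A (\<Phi> p) \<partial>(lborel \<Otimes>\<^sub>M other_coords k))"
      by (subst nn_integral_distr, (simp; fail), measurable, rule nn_integral_density, auto)
    also have "\<dots> = (\<integral>\<^sup>+ r. \<integral>\<^sup>+ y. ennreal (hemisphere_density x0 k r y) * indicator A (hemisphere_point x0 k s r y)
            \<partial>other_coords k \<partial>lborel)"
      by (subst M2.nn_integral_fst[symmetric]) (auto simp: w_def \<Phi>_def)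
    also have "\<dots> = (\<integral>\<^sup>+ x. indicator A x * indicator ?H x \<partial>lborel)"
      by (rule nn_integral_hemispheres[OF _ s]) auto
    also have "\<dots> = emeasure ?L A"
      by (simp add: emeasure_density mult.commute ennreal_indicator)
    finally show "emeasure ?D A = emeasure ?L A" .
  qed simp
  have "integrable lborel (\<lambda>x. indicator ?H x *\<^sub>R F x)"
    by (rule integrable_mult_indicator) (use F in auto)
  then have "integrable ?L F"
    by (subst integrable_density) auto
  then have "integrable (density (lborel \<Otimes>\<^sub>M other_coords k) (\<lambda>p. ennreal (w p))) (\<lambda>p. F (\<Phi> p))"
    unfolding eq[symmetric] by (subst (asm) integrable_distr_eq) auto
  then have int: "integrable (lborel \<Otimes>\<^sub>M other_coords k) (\<lambda>p. w p * F (\<Phi> p))"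
    by (subst (asm) integrable_density) (auto simp: w_nonneg)
  have hemi: "integrable (hemisphere_measure x0 k s r) F
        \<longleftrightarrow> integrable (other_coords k) (\<lambda>y. w (r, y) * F (\<Phi> (r, y)))"
      "(\<integral> x. F x \<partial>hemisphere_measure x0 k s r) = (\<integral> y. w (r, y) * F (\<Phi> (r, y)) \<partial>other_coords k)" for r
    unfolding hemisphere_measure_def w_def \<Phi>_def
    by (subst integrable_distr_eq integral_distr, measurable,
        subst integrable_density integral_density, auto simp: hemisphere_density_nonneg)+
  have w0: "w (r, y) = 0" if "\<not> 0 < r" for r y
    using that by (simp add: w_def hemisphere_density_def)
  have ind: "indicator {0<..} r * (\<integral> x. F x \<partial>hemisphere_measure x0 k s r)
      = (\<integral> y. w (r, y) * F (\<Phi> (r, y)) \<partial>other_coords k)" for r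
    by (cases "0 < r") (simp_all add: hemi w0)
  show "AE r in lborel. 0 < r \<longrightarrow> integrable (hemisphere_measure x0 k s r) F"
    using AE_integrable_fst'[OF int] by eventually_elim (simp add: hemi)
  show "integrable lborel (\<lambda>r. indicator {0<..} r * (\<integral> x. F x \<partial>hemisphere_measure x0 k s r))"
    using integrable_fst'[OF int] by (simp add: ind)
  have "(\<integral> r. indicator {0<..} r * (\<integral> x. F x \<partial>hemisphere_measure x0 k s r) \<partial>lborel)
      = (\<integral> p. w p * F (\<Phi> p) \<partial>(lborel \<Otimes>\<^sub>M other_coords k))"
    using integral_fst'[OF int] by (simp add: ind)
  also have "\<dots> = (\<integral> x. F x \<partial>?D)"
    by (subst integral_distr, measurable, subst integral_density) (auto simp: w_nonneg)
  also have "\<dots> = (\<integral> x. indicator ?H x * F x \<partial>lborel)"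
    unfolding eq by (subst integral_density) auto
  finally show "(\<integral> r. indicator {0<..} r * (\<integral> x. F x \<partial>hemisphere_measure x0 k s r) \<partial>lborel)
      = (\<integral> x. indicator ?H x * F x \<partial>lborel)" .
qed

text \<open>
  The gradient of the height has squared length \<open>q / (r^2 - q)\<close>, so the area factor is
  \<open>r / sqrt (r^2 - q)\<close>.
\<close>

lemma graph_measure_eq_hemisphere_measure:
  assumes "0 < r" and s: "s \<in> {1, -1}"
  shows "graph_measure k {y. plane_dist2 x0 k y < r\<^sup>2} (\<lambda>y. x0 $ k + s * sqrt (r\<^sup>2 - plane_dist2 x0 k y))
    = hemisphere_measure x0 k s r"
proof -
  let ?q = "plane_dist2 x0 k" and ?h = "\<lambda>y. x0 $ k + s * sqrt (r\<^sup>2 - plane_dist2 x0 k y)"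
  have "indicator {y. ?q y < r\<^sup>2} y * sqrt (1 + (\<Sum>j\<in>- {k}. (deriv (\<lambda>t. ?h (y(j := t))) (y j))\<^sup>2))
      = hemisphere_density x0 k r y" for y
  proof (cases "?q y < r\<^sup>2")
    case True
    have deriv: "deriv (\<lambda>t. ?h (y(j := t))) (y j) = - s * (y j - x0 $ j) / sqrt (r\<^sup>2 - ?q y)"
      if j: "j \<in> - {k}" for j
    proof -
      define C where "C = (\<Sum>i\<in>- {k} - {j}. (y i - x0 $ i)\<^sup>2)"
      have q: "?q (y(j := t)) = (t - x0 $ j)\<^sup>2 + C" for t
        unfolding plane_dist2_def C_def using j by (subst sum.remove[of _ j]) (auto intro!: sum.cong)
      have qy: "?q y = (y j - x0 $ j)\<^sup>2 + C"
        using q[of "y j"] by simp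
      have "((\<lambda>t. x0 $ k + s * sqrt (r\<^sup>2 - ((t - x0 $ j)\<^sup>2 + C))) has_real_derivative
          - s * (y j - x0 $ j) / sqrt (r\<^sup>2 - ((y j - x0 $ j)\<^sup>2 + C))) (at (y j))"
        using True unfolding qy by (auto intro!: derivative_eq_intros simp: divide_simps) (simp add: algebra_simps)
      then have "((\<lambda>t. ?h (y(j := t))) has_real_derivative - s * (y j - x0 $ j) / sqrt (r\<^sup>2 - ?q y)) (at (y j))"
        unfolding q qy .
      then show ?thesis by (rule DERIV_imp_deriv)
    qed
    have "(\<Sum>j\<in>- {k}. (deriv (\<lambda>t. ?h (y(j := t))) (y j))\<^sup>2)
        = (\<Sum>j\<in>- {k}. (y j - x0 $ j)\<^sup>2 / (r\<^sup>2 - ?q y))"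
      using s True by (intro sum.cong refl) (auto simp: deriv power_divide power_mult_distrib)
    also have "\<dots> = ?q y / (r\<^sup>2 - ?q y)"
      by (simp add: plane_dist2_def sum_divide_distrib)
    finally have "1 + (\<Sum>j\<in>- {k}. (deriv (\<lambda>t. ?h (y(j := t))) (y j))\<^sup>2) = r\<^sup>2 / (r\<^sup>2 - ?q y)"
      using True by (simp add: field_simps)
    then show ?thesis
      using True \<open>0 < r\<close> by (simp add: hemisphere_density_def real_sqrt_divide)
  qed (simp add: hemisphere_density_def)
  then show ?thesis
    unfolding graph_measure_def hemisphere_measure_def hemisphere_point_def[abs_def] insert_coord_def by simp
qed

section \<open>Polar integration over spheres\<close>

text \<open>
  The sphere measure is by definition such a sum, of the measures of its two hemispheres.
\<close>

definition borel_measure_sum :: "'a::topological_space measure \<Rightarrow> 'a measure \<Rightarrow> 'a measure" where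
  "borel_measure_sum M N = measure_of UNIV (sets borel) (\<lambda>A. emeasure M A + emeasure N A)"

lemma sets_borel_measure_sum [simp, measurable_cong]: "sets (borel_measure_sum M N) = sets borel"
  unfolding borel_measure_sum_def using sets.sets_measure_of_eq[of borel] by simp

lemma space_borel_measure_sum [simp]: "space (borel_measure_sum M N) = UNIV"
  by (simp add: borel_measure_sum_def)

context
  fixes M N :: "'a::topological_space measure"
  assumes sets_M: "sets M = sets borel" and sets_N: "sets N = sets borel"
begin

lemma emeasure_borel_measure_sum:
  assumes "A \<in> sets borel"
  shows "emeasure (borel_measure_sum M N) A = emeasure M A + emeasure N A"
proof (rule emeasure_measure_of[OF borel_measure_sum_def])
  show "countably_additive (sets (borel_measure_sum M N)) (\<lambda>A. emeasure M A + emeasure N A)"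
    by (auto simp: countably_additive_def sets_M sets_N suminf_add[symmetric] intro!: suminf_emeasure arg_cong2[of _ _ _ _ "(+)"])
qed (use assms in \<open>auto simp: positive_def\<close>)

lemma nn_integral_borel_measure_sum:
  assumes "f \<in> borel_measurable borel"
  shows "(\<integral>\<^sup>+ x. f x \<partial>borel_measure_sum M N) = (\<integral>\<^sup>+ x. f x \<partial>M) + (\<integral>\<^sup>+ x. f x \<partial>N)"
proof -
  have meas: "g \<in> borel_measurable M" "g \<in> borel_measurable N" "g \<in> borel_measurable (borel_measure_sum M N)"
    if "g \<in> borel_measurable borel" for g :: "'a \<Rightarrow> ennreal"
    using that sets_M sets_N by (simp_all cong: measurable_cong_sets)
  show ?thesis
    using assms
  proof (induction rule: borel_measurable_induct)
    case (cong f g)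
    then show ?case by simp
  next
    case (set A)
    then show ?case by (simp add: sets_M sets_N emeasure_borel_measure_sum)
  next
    case (mult u c)
    then show ?case by (simp add: nn_integral_cmult meas distrib_left)
  next
    case (add u v)
    then show ?case by (simp add: nn_integral_add meas add_ac)
  next
    case (seq U)
    have mono: "incseq (\<lambda>i. integral\<^sup>N M (U i))" "incseq (\<lambda>i. integral\<^sup>N N (U i))"
      using seq(3) by (auto simp: incseq_def le_fun_def intro!: nn_integral_mono)
    have "(\<integral>\<^sup>+ x. (SUP i. U i) x \<partial>borel_measure_sum M N) = (SUP i. integral\<^sup>N M (U i) + integral\<^sup>N N (U i))"
      using seq by (simp add: image_comp nn_integral_monotone_convergence_SUP meas)
    also have "\<dots> = (SUP i. integral\<^sup>N M (U i)) + (SUP i. integral\<^sup>N N (U i))"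
      by (rule ennreal_SUP_add[OF mono])
    also have "\<dots> = (\<integral>\<^sup>+ x. (SUP i. U i) x \<partial>M) + (\<integral>\<^sup>+ x. (SUP i. U i) x \<partial>N)"
      using seq by (simp add: image_comp nn_integral_monotone_convergence_SUP meas)
    finally show ?case .
  qed
qed

lemma integral_borel_measure_sum:
  fixes f :: "'a \<Rightarrow> real"
  assumes "integrable M f" "integrable N f"
  shows "(\<integral> x. f x \<partial>borel_measure_sum M N) = (\<integral> x. f x \<partial>M) + (\<integral> x. f x \<partial>N)"
proof -
  have f [measurable]: "f \<in> borel_measurable borel"
    using assms(1) sets_M by (auto dest!: borel_measurable_integrable cong: measurable_cong_sets)
  then have fsum: "f \<in> borel_measurable (borel_measure_sum M N)"
    by (simp cong: measurable_cong_sets)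
  have fin: "(\<integral>\<^sup>+ x. ennreal (f x) \<partial>L) \<noteq> \<infinity>" "(\<integral>\<^sup>+ x. ennreal (- f x) \<partial>L) \<noteq> \<infinity>"
    if "L \<in> {M, N}" for L
    using that assms by (auto simp: real_integrable_def)
  have int: "integrable (borel_measure_sum M N) f"
    using fin by (auto simp: real_integrable_def fsum nn_integral_borel_measure_sum)
  have split: "enn2real (a + b) = enn2real a + enn2real b" if "a \<noteq> \<infinity>" "b \<noteq> \<infinity>" for a b :: ennreal
    using that by (intro enn2real_plus) (auto simp: top.not_eq_extremum)
  show "(\<integral> x. f x \<partial>borel_measure_sum M N) = (\<integral> x. f x \<partial>M) + (\<integral> x. f x \<partial>N)"
    using fin by (simp add: real_lebesgue_integral_def[OF int] real_lebesgue_integral_def[OF assms(1)]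
        real_lebesgue_integral_def[OF assms(2)] nn_integral_borel_measure_sum split)
qed

end

lemma sets_hemisphere_measure [simp, measurable_cong]: "sets (hemisphere_measure x0 k s r) = sets borel"
  by (simp add: hemisphere_measure_def)

lemma sphere_measure_eq:
  obtains k :: "'n::finite"
  where "\<And>(x0 :: real^'n) r. 0 < r \<Longrightarrow>
    sphere_measure x0 r = borel_measure_sum (hemisphere_measure x0 k 1 r) (hemisphere_measure x0 k (- 1) r)"
proof
  fix x0 :: "real^'n" and r :: real assume "0 < r"
  then show "sphere_measure x0 r = borel_measure_sum (hemisphere_measure x0 (SOME k. True) 1 r)
      (hemisphere_measure x0 (SOME k. True) (- 1) r)"
    unfolding sphere_measure_def borel_measure_sum_def Let_def
    using graph_measure_eq_hemisphere_measure[of r 1 "SOME k. True" x0]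
      graph_measure_eq_hemisphere_measure[of r "- 1" "SOME k. True" x0]
    by (simp add: plane_dist2_def)
qed

lemma AE_sphere_measure_dist:
  assumes "0 < r"
  shows "AE x in sphere_measure x0 r. dist x x0 = r"
proof -
  obtain k where k: "sphere_measure x0 r
      = borel_measure_sum (hemisphere_measure x0 k 1 r) (hemisphere_measure x0 k (- 1) r)"
    using sphere_measure_eq assms by metis
  have null: "(\<integral>\<^sup>+ x. indicator {x. dist x x0 \<noteq> r} x \<partial>hemisphere_measure x0 k s r) = 0" if "s \<in> {1, -1}" for s
  proof -
    have "ennreal (hemisphere_density x0 k r y) * indicator {x. dist x x0 \<noteq> r} (hemisphere_point x0 k s r y) = 0" for y
      using dist_hemisphere_point[OF that assms, of x0 k y] by (simp add: hemisphere_density_def)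
    then show ?thesis
      by (subst nn_integral_hemisphere_measure) (measurable, simp only: nn_integral_const mult_zero_left)
  qed
  have "emeasure (sphere_measure x0 r) {x. dist x x0 \<noteq> r} = 0"
    unfolding k using null[of 1] null[of "- 1"] by (subst emeasure_borel_measure_sum) auto
  then show ?thesis
    by (intro AE_I[where N = "{x. dist x x0 \<noteq> r}"]) (auto simp: k)
qed

text \<open>
  The two half-spaces miss the hyperplane through the centre; it is a null set.
\<close>

lemma AE_lborel_coordinate_neq:
  fixes k :: "'n::finite"
  shows "AE x in (lborel :: (real^'n) measure). x $ k \<noteq> c"
proof -
  have ind: "indicator {x. x $ k = c} (insert_coord k y t) = (indicator {c} t :: ennreal)" for y t
    by (simp add: indicator_def)
  have "emeasure (lborel :: (real^'n) measure) {x. x $ k = c} = (\<integral>\<^sup>+ x. indicator {x. x $ k = c} (x :: real^'n) \<partial>lborel)"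
    by simp
  also have "\<dots> = (\<integral>\<^sup>+ y. \<integral>\<^sup>+ t. indicator {c} t \<partial>lborel \<partial>other_coords k)"
    by (subst nn_integral_lborel_insert_coord[of _ k]) (measurable, simp only: ind)
  finally have "emeasure (lborel :: (real^'n) measure) {x. x $ k = c} = 0" by simp
  then show ?thesis
    by (intro AE_I[where N = "{x. x $ k = c}"]) auto
qed

text \<open>
  On radii where the integrand is not integrable the integral has the default value 0.  Measurability
  in \<open>r\<close> therefore goes through the nonnegative integrals of the positive and the negative part, which
  are measurable and also detect integrability.
\<close>

lemma measurable_sphere_integral:
  fixes F :: "real^'n \<Rightarrow> real"
  assumes [measurable]: "F \<in> borel_measurable borel"
  shows "(\<lambda>r. indicator {0<..} r * (\<integral> x. F x \<partial>sphere_measure x0 r)) \<in> borel_measurable borel"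
proof -
  obtain k where k: "\<And>r. 0 < r \<Longrightarrow> sphere_measure x0 r
      = borel_measure_sum (hemisphere_measure x0 k 1 r) (hemisphere_measure x0 k (- 1) r)"
    using sphere_measure_eq by metis
  interpret other: sigma_finite_measure "other_coords k" by (rule sigma_finite_other_coords)
  define J where "J g r = (\<integral>\<^sup>+ y. ennreal (hemisphere_density x0 k r y) * g (hemisphere_point x0 k 1 r y) \<partial>other_coords k)
      + (\<integral>\<^sup>+ y. ennreal (hemisphere_density x0 k r y) * g (hemisphere_point x0 k (- 1) r y) \<partial>other_coords k)" for g r
  have J: "(\<integral>\<^sup>+ x. g x \<partial>sphere_measure x0 r) = J g r"
    if "0 < r" "g \<in> borel_measurable borel" for g r
    using that by (simp add: k J_def nn_integral_borel_measure_sum nn_integral_hemisphere_measure)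
  have [measurable]: "J g \<in> borel_measurable borel" if [measurable]: "g \<in> borel_measurable borel" for g
    unfolding J_def[abs_def] by measurable
  let ?p = "J (\<lambda>x. ennreal (F x))" and ?m = "J (\<lambda>x. ennreal (- F x))"
  have "indicator {0<..} r * (\<integral> x. F x \<partial>sphere_measure x0 r)
      = (if 0 < r \<and> ?p r \<noteq> \<infinity> \<and> ?m r \<noteq> \<infinity> then enn2real (?p r) - enn2real (?m r) else 0)" for r
  proof (cases "0 < r")
    case True
    have "F \<in> borel_measurable (sphere_measure x0 r)"
      using True by (simp add: k cong: measurable_cong_sets)
    then have iff: "integrable (sphere_measure x0 r) F \<longleftrightarrow> ?p r \<noteq> \<infinity> \<and> ?m r \<noteq> \<infinity>"
      using True by (simp add: real_integrable_def J)
    show ?thesis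
    proof (cases "integrable (sphere_measure x0 r) F")
      case int: True
      then show ?thesis using iff True by (simp add: real_lebesgue_integral_def[OF int] J)
    next
      case False
      then have "(\<integral> x. F x \<partial>sphere_measure x0 r) = 0" by (rule not_integrable_integral_eq)
      moreover have "(0 < r \<and> ?p r \<noteq> \<infinity> \<and> ?m r \<noteq> \<infinity>) = False" using False iff by blast
      ultimately show ?thesis by (simp only: if_False mult_zero_right)
    qed
  qed simp
  then show ?thesis by simp
qed

text \<open>
  Almost every sphere integral splits into its two hemispheres, each of which is covered by
  \<open>integral_hemispheres\<close>.
\<close>

theorem integral_polar:
  fixes F :: "real^'n \<Rightarrow> real"
  assumes F: "integrable lborel F"
  shows "(\<integral> r. indicator {0<..} r * (\<integral> x. F x \<partial>sphere_measure x0 r) \<partial>lborel) = (\<integral> x. F x \<partial>lborel)"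
proof -
  obtain k where k: "\<And>r. 0 < r \<Longrightarrow> sphere_measure x0 r
      = borel_measure_sum (hemisphere_measure x0 k 1 r) (hemisphere_measure x0 k (- 1) r)"
    using sphere_measure_eq by metis
  have F_meas [measurable]: "F \<in> borel_measurable borel" using F by auto
  let ?h = "\<lambda>s r. indicator {0<..} r * (\<integral> x. F x \<partial>hemisphere_measure x0 k s r)"
  let ?H = "\<lambda>s. {x. 0 < s * (x $ k - x0 $ k)}"
  have int: "integrable lborel (?h 1)" "integrable lborel (?h (- 1))"
    by (rule integrable_hemisphere_integrals[OF F]; simp)+
  have int': "integrable lborel (\<lambda>x. indicator (?H s) x * F x)" for s
    using integrable_mult_indicator[OF _ F, of "?H s"] by simp
  have ae: "AE r in lborel. indicator {0<..} r * (\<integral> x. F x \<partial>sphere_measure x0 r) = ?h 1 r + ?h (- 1) r"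
    using AE_integrable_hemisphere[OF F, of 1 x0 k, simplified] AE_integrable_hemisphere[OF F, of "- 1" x0 k, simplified]
  proof eventually_elim
    case (elim r)
    then show ?case
      by (cases "0 < r") (simp_all add: k integral_borel_measure_sum)
  qed
  have "(\<integral> r. indicator {0<..} r * (\<integral> x. F x \<partial>sphere_measure x0 r) \<partial>lborel) = (\<integral> r. ?h 1 r + ?h (- 1) r \<partial>lborel)"
    using int measurable_sphere_integral[OF F_meas] ae by (intro integral_cong_AE) auto
  also have "\<dots> = (\<integral> r. ?h 1 r \<partial>lborel) + (\<integral> r. ?h (- 1) r \<partial>lborel)"
    using int by (rule Bochner_Integration.integral_add)
  also have "\<dots> = (\<integral> x. indicator (?H 1) x * F x \<partial>lborel) + (\<integral> x. indicator (?H (- 1)) x * F x \<partial>lborel)"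
    by (simp only: integral_hemispheres[OF F] insertI1 insertI2)
  also have "\<dots> = (\<integral> x. indicator (?H 1) x * F x + indicator (?H (- 1)) x * F x \<partial>lborel)"
    by (intro Bochner_Integration.integral_add[symmetric] int')
  also have "\<dots> = (\<integral> x. F x \<partial>lborel)"
  proof (rule integral_cong_AE)
    show "AE x in lborel. indicator (?H 1) x * F x + indicator (?H (- 1)) x * F x = F x"
      using AE_lborel_coordinate_neq[of k "x0 $ k"] by eventually_elim (auto split: split_indicator)
  qed measurable
  finally show ?thesis .
qed

lemma sets_sphere_measure: "0 < r \<Longrightarrow> sets (sphere_measure x0 r) = sets borel"
  by (metis sphere_measure_eq sets_borel_measure_sum)

text \<open>
  On a sphere about \<open>x0\<close> the radial factors are constant and can be taken out of the inner integral.
\<close>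

lemma integral_annulus_polar:
  fixes f :: "real^'n \<Rightarrow> real" and w :: "real \<Rightarrow> real"
  assumes "0 < R1" and [measurable]: "f \<in> borel_measurable borel" "w \<in> borel_measurable borel"
    and int: "integrable lborel (\<lambda>x. indicator {R1..R2} (dist x x0) * w (dist x x0) * f x)"
  shows "(\<integral> x. indicator {R1..R2} (dist x x0) * w (dist x x0) * f x \<partial>lborel)
    = (LINT r:{R1..R2}|lborel. w r * (LINT x|sphere_measure x0 r. f x))"
proof -
  let ?F = "\<lambda>x. indicator {R1..R2} (dist x x0) * w (dist x x0) * f x"
  have "indicator {0<..} r * (\<integral> x. ?F x \<partial>sphere_measure x0 r)
      = indicator {R1..R2} r *\<^sub>R (w r * (\<integral> x. f x \<partial>sphere_measure x0 r))" for r
  proof (cases "0 < r")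
    case True
    have meas: "g \<in> borel_measurable (sphere_measure x0 r)" if "g \<in> borel_measurable borel" for g :: "real^'n \<Rightarrow> real"
      using that by (simp add: measurable_cong_sets[OF sets_sphere_measure[OF True] refl])
    have "(\<integral> x. ?F x \<partial>sphere_measure x0 r)
        = (\<integral> x. indicator {R1..R2} r * w r * f x \<partial>sphere_measure x0 r)"
    proof (rule integral_cong_AE)
      show "?F \<in> borel_measurable (sphere_measure x0 r)"
        by (rule meas) measurable
      show "(\<lambda>x. indicator {R1..R2} r * w r * f x) \<in> borel_measurable (sphere_measure x0 r)"
        by (rule meas) measurable
      show "AE x in sphere_measure x0 r. ?F x = indicator {R1..R2} r * w r * f x"
        using AE_sphere_measure_dist[OF True, of x0] by eventually_elim simp
    qed
    then show ?thesis using True by simp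
  next
    case False
    then show ?thesis using \<open>0 < R1\<close> by simp
  qed
  then show ?thesis
    using integral_polar[OF int, of x0] by (simp add: set_lebesgue_integral_def)
qed

section \<open>Integrals of derivatives of Lipschitz functions\<close>

text \<open>
  Translation invariance makes the integral of every difference quotient vanish; the Lipschitz bound
  dominates the quotients, so the integral passes to the limit.
\<close>

lemma integral_directional_derivative_eq_0:
  fixes f g :: "'a::euclidean_space \<Rightarrow> real"
  assumes lip: "\<And>x y. \<bar>f x - f y\<bar> \<le> L * dist x y"
    and supp: "\<And>x. r < dist a x \<Longrightarrow> f x = 0"
    and deriv: "AE x in lborel. ((\<lambda>t. f (x + t *\<^sub>R v)) has_real_derivative g x) (at 0)"
    and [measurable]: "g \<in> borel_measurable borel"
  shows "(\<integral> x. g x \<partial>lborel) = 0"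
proof -
  define h where "h m = 1 / real (Suc m)" for m
  define s where "s m x = (f (x + h m *\<^sub>R v) - f x) / h m" for m x
  have h: "0 < h m" "h m \<le> 1" for m by (auto simp: h_def)
  have L: "0 \<le> L"
  proof -
    obtain b :: 'a where "b \<in> Basis" using nonempty_Basis by blast
    then show ?thesis using lip[of b 0] by simp
  qed
  have "L-lipschitz_on UNIV f"
    using lip L by (auto simp: lipschitz_on_def dist_real_def)
  then have cont: "continuous_on UNIV f" by (rule lipschitz_on_continuous_on)
  then have [measurable]: "f \<in> borel_measurable borel" by (rule borel_measurable_continuous_onI)
  have "integrable lborel (\<lambda>x. indicator (cball a r) x *\<^sub>R f x)"
    using continuous_on_subset[OF cont] by (intro borel_integrable_compact) auto
  moreover have "indicator (cball a r) x *\<^sub>R f x = f x" for x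
    using supp[of x] by (auto simp: indicator_def not_le)
  ultimately have f_int: "integrable lborel f" by (simp only:)
  have shift: "integrable lborel (\<lambda>x. f (x + w))" "(\<integral> x. f (x + w) \<partial>lborel) = (\<integral> x. f x \<partial>lborel)" for w
  proof -
    have *: "lborel = distr lborel borel ((+) w)" by (rule lborel_distr_plus[symmetric])
    have "integrable (distr lborel borel ((+) w)) f" using f_int * by simp
    then show "integrable lborel (\<lambda>x. f (x + w))"
      by (subst (asm) integrable_distr_eq) (auto simp: add.commute)
    have "(\<integral> x. f x \<partial>lborel) = (\<integral> x. f x \<partial>distr lborel borel ((+) w))" using * by simp
    also have "\<dots> = (\<integral> x. f (x + w) \<partial>lborel)" by (subst integral_distr) (auto simp: add.commute)
    finally show "(\<integral> x. f (x + w) \<partial>lborel) = (\<integral> x. f x \<partial>lborel)" ..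
  qed
  have s0: "(\<integral> x. s m x \<partial>lborel) = 0" for m
    unfolding s_def using f_int shift by simp
  let ?dom = "\<lambda>x. indicator (cball a (r + norm v)) x *\<^sub>R (L * norm v)"
  have dom: "norm (s m x) \<le> ?dom x" for m x
  proof (cases "x \<in> cball a (r + norm v)")
    case True
    have "\<bar>s m x\<bar> = \<bar>f (x + h m *\<^sub>R v) - f x\<bar> / h m" using h[of m] by (simp add: s_def)
    also have "\<dots> \<le> L * dist (x + h m *\<^sub>R v) x / h m" using h[of m] by (intro divide_right_mono lip) auto
    also have "\<dots> = L * norm v" using h[of m] by (simp add: dist_norm)
    finally show ?thesis using True by simp
  next
    case False
    have "norm (h m *\<^sub>R v) \<le> norm v" using h[of m] by (simp add: mult_left_le_one_le)
    moreover have "dist a x \<le> dist a (x + h m *\<^sub>R v) + norm (h m *\<^sub>R v)"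
      using dist_triangle[of a x "x + h m *\<^sub>R v"] by (simp add: dist_norm)
    ultimately have "r < dist a (x + h m *\<^sub>R v)" "r < dist a x"
      using False norm_ge_zero[of v] by (auto simp del: norm_ge_zero)
    then show ?thesis using False supp by (simp add: s_def)
  qed
  have dom_int: "integrable lborel ?dom"
    by (intro borel_integrable_compact continuous_intros) auto
  have lim: "AE x in lborel. (\<lambda>m. s m x) \<longlonglongrightarrow> g x"
    using deriv
  proof eventually_elim
    case (elim x)
    have "(\<lambda>t. (f (x + t *\<^sub>R v) - f x) / t) \<midarrow>0\<rightarrow> g x"
      using elim by (simp add: DERIV_def)
    moreover have "filterlim h (at 0) sequentially"
      unfolding h_def filterlim_at using LIMSEQ_inverse_real_of_nat by (auto simp: inverse_eq_divide)
    ultimately show ?case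
      unfolding s_def by (rule filterlim_compose)
  qed
  have s_meas: "s m \<in> borel_measurable lborel" for m
    unfolding s_def[abs_def] by measurable
  have "(\<lambda>m. \<integral> x. s m x \<partial>lborel) \<longlonglongrightarrow> (\<integral> x. g x \<partial>lborel)"
    using lim dom by (intro integral_dominated_convergence[OF _ s_meas dom_int]) auto
  then show "(\<integral> x. g x \<partial>lborel) = 0"
    using s0 by (simp add: LIMSEQ_const_iff)
qed

text \<open>
  The finitely many partial derivatives are bounded on the compact ball, and these bounds control the
  operator norm of the derivative.
\<close>

lemma C1_lipschitz_on_cball:
  fixes f :: "'a::euclidean_space \<Rightarrow> real"
  assumes deriv: "\<And>x. (f has_derivative f' x) (at x)"
    and cont: "\<And>v. continuous_on UNIV (\<lambda>x. f' x v)"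
  shows "\<exists>L. L-lipschitz_on (cball a r) f"
proof -
  have "bounded ((\<lambda>x. f' x b) ` cball a r)" for b
    using continuous_on_subset[OF cont] by (intro compact_imp_bounded compact_continuous_image) auto
  then have "\<exists>B. \<forall>x\<in>cball a r. \<bar>f' x b\<bar> \<le> B" for b
    by (auto simp: bounded_iff)
  then obtain B where B: "\<And>b x. x \<in> cball a r \<Longrightarrow> \<bar>f' x b\<bar> \<le> B b"
    by metis
  define L where "L = (\<Sum>b\<in>(Basis :: 'a set). \<bar>B b\<bar>)"
  have bound: "onorm (f' x) \<le> L" if x: "x \<in> cball a r" for x
  proof (rule onorm_le)
    fix v
    have lin: "linear (f' x)" using deriv by (rule has_derivative_linear)
    have "f' x v = (\<Sum>b\<in>Basis. (v \<bullet> b) * f' x b)"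
      by (subst euclidean_representation[of v, symmetric])
         (simp only: linear_sum[OF lin] linear_cmul[OF lin] real_scaleR_def)
    then have "norm (f' x v) \<le> (\<Sum>b\<in>Basis. \<bar>v \<bullet> b\<bar> * \<bar>f' x b\<bar>)"
      using sum_abs[of "\<lambda>b. (v \<bullet> b) * f' x b" Basis] by (simp add: abs_mult)
    also have "\<dots> \<le> (\<Sum>b\<in>Basis. norm v * \<bar>B b\<bar>)"
      using B[OF x] by (intro sum_mono mult_mono Basis_le_norm) (auto intro: order_trans[OF _ abs_ge_self])
    finally show "norm (f' x v) \<le> L * norm v"
      by (simp add: L_def sum_distrib_left mult.commute)
  qed
  have "L-lipschitz_on (cball a r) f"
  proof (rule lipschitz_onI)
    fix x y assume "x \<in> cball a r" "y \<in> cball a r"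
    then show "dist (f x) (f y) \<le> L * dist x y"
      using differentiable_bound[of "cball a r" f f' L x y] bound deriv
      by (auto simp: dist_norm intro: has_derivative_at_withinI)
  qed (simp add: L_def sum_nonneg)
  then show ?thesis ..
qed

text \<open>
  The product rule for Lipschitz constants on the ball that carries \<open>\<eta>\<close>.  If \<open>y\<close> lies outside this
  ball, then \<open>\<eta> y = 0\<close>, and \<open>\<bar>\<eta> x\<bar> = \<bar>\<eta> x - \<eta> y\<bar>\<close> is already small.
\<close>

lemma lipschitz_cutoff_times_C1:
  fixes f :: "'a::euclidean_space \<Rightarrow> real" and \<eta> :: "'a \<Rightarrow> real"
  assumes deriv: "\<And>x. (f has_derivative f' x) (at x)"
    and cont: "\<And>v. continuous_on UNIV (\<lambda>x. f' x v)"
    and \<eta>: "K-lipschitz_on UNIV \<eta>" and supp: "\<And>x. r < dist a x \<Longrightarrow> \<eta> x = 0"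
  shows "\<exists>L. \<forall>x y. \<bar>\<eta> x * f x - \<eta> y * f y\<bar> \<le> L * dist x y"
proof -
  obtain L where L: "L-lipschitz_on (cball a r) f"
    using C1_lipschitz_on_cball[OF deriv cont] by blast
  have bdd: "\<exists>M\<ge>0. \<forall>x\<in>cball a r. \<bar>g x\<bar> \<le> M" if "continuous_on UNIV g" for g :: "'a \<Rightarrow> real"
  proof -
    have "bounded (g ` cball a r)"
      using continuous_on_subset[OF that] by (intro compact_imp_bounded compact_continuous_image) auto
    then obtain M where "\<forall>x\<in>cball a r. \<bar>g x\<bar> \<le> M" by (auto simp: bounded_iff)
    then show ?thesis by (intro exI[of _ "\<bar>M\<bar>"]) (auto intro: order_trans)
  qed
  have "continuous_on UNIV f"
    using deriv by (auto intro!: continuous_at_imp_continuous_on has_derivative_continuous)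
  then obtain M where M: "0 \<le> M" "\<And>x. x \<in> cball a r \<Longrightarrow> \<bar>f x\<bar> \<le> M" using bdd by blast
  obtain N where N: "0 \<le> N" "\<And>x. x \<in> cball a r \<Longrightarrow> \<bar>\<eta> x\<bar> \<le> N"
    using bdd[OF lipschitz_on_continuous_on[OF \<eta>]] by blast
  have K: "0 \<le> K" "\<bar>\<eta> x - \<eta> y\<bar> \<le> K * dist x y" for x y
    using \<eta> by (auto simp: lipschitz_on_def dist_real_def)
  have L': "0 \<le> L" "x \<in> cball a r \<Longrightarrow> y \<in> cball a r \<Longrightarrow> \<bar>f x - f y\<bar> \<le> L * dist x y" for x y
    using L by (auto simp: lipschitz_on_def dist_real_def)
  have one_in: "\<bar>\<eta> x * f x - \<eta> y * f y\<bar> \<le> (K * M + N * L) * dist x y" if x: "x \<in> cball a r" for x y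
  proof (cases "y \<in> cball a r")
    case True
    have "\<eta> x * f x - \<eta> y * f y = (\<eta> x - \<eta> y) * f x + \<eta> y * (f x - f y)"
      by (simp add: algebra_simps)
    also have "\<bar>\<dots>\<bar> \<le> \<bar>\<eta> x - \<eta> y\<bar> * \<bar>f x\<bar> + \<bar>\<eta> y\<bar> * \<bar>f x - f y\<bar>"
      by (metis abs_mult abs_triangle_ineq)
    also have "\<dots> \<le> (K * dist x y) * M + N * (L * dist x y)"
      using x True M N K L' by (intro add_mono mult_mono) auto
    finally show ?thesis by (simp add: algebra_simps)
  next
    case False
    then have y: "\<eta> y = 0" using supp[of y] by simp
    then have "\<bar>\<eta> x * f x - \<eta> y * f y\<bar> = \<bar>\<eta> x - \<eta> y\<bar> * \<bar>f x\<bar>" by (simp add: abs_mult)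
    also have "\<dots> \<le> (K * dist x y) * M"
      using x M K by (intro mult_mono) auto
    also have "\<dots> \<le> (K * M + N * L) * dist x y"
      using N L'(1) by (simp add: algebra_simps)
    finally show ?thesis .
  qed
  have "\<bar>\<eta> x * f x - \<eta> y * f y\<bar> \<le> (K * M + N * L) * dist x y" for x y
  proof (cases "x \<in> cball a r \<or> y \<in> cball a r")
    case True
    then show ?thesis using one_in[of x y] one_in[of y x] by (auto simp: dist_commute abs_minus_commute)
  next
    case False
    then show ?thesis using supp[of x] supp[of y] K L' M N by simp
  qed
  then show ?thesis by blast
qed

section \<open>Symmetry of second derivatives\<close>

text \<open>
  The mean value theorem applied in direction \<open>v\<close> and then in direction \<open>w\<close>.
\<close>

lemma mean_value_second_difference:
  fixes f :: "'a::real_normed_vector \<Rightarrow> real"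
  assumes fv: "\<And>x. ((\<lambda>t. f (x + t *\<^sub>R v)) has_real_derivative fv x) (at 0)"
    and fvw: "\<And>x. ((\<lambda>t. fv (x + t *\<^sub>R w)) has_real_derivative fvw x) (at 0)"
    and "0 < h"
  shows "\<exists>s t. 0 < s \<and> s < h \<and> 0 < t \<and> t < h \<and>
    f (x + h *\<^sub>R v + h *\<^sub>R w) - f (x + h *\<^sub>R v) - f (x + h *\<^sub>R w) + f x
      = h * (h * fvw (x + s *\<^sub>R v + t *\<^sub>R w))"
proof -
  have shift: "((\<lambda>t. g (x + t *\<^sub>R u)) has_real_derivative g' (x + t *\<^sub>R u)) (at t)"
    if "\<And>x. ((\<lambda>t. g (x + t *\<^sub>R u)) has_real_derivative g' x) (at 0)" for g g' :: "'a \<Rightarrow> real" and x u t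
    using that[of "x + t *\<^sub>R u"]
      DERIV_shift[of "\<lambda>t. g (x + t *\<^sub>R u)" "g' (x + t *\<^sub>R u)" 0 t]
    by (simp add: algebra_simps)
  define \<phi> where "\<phi> s = f (x + h *\<^sub>R w + s *\<^sub>R v) - f (x + s *\<^sub>R v)" for s
  have \<phi>': "(\<phi> has_real_derivative fv (x + h *\<^sub>R w + s *\<^sub>R v) - fv (x + s *\<^sub>R v)) (at s)" for s
    unfolding \<phi>_def[abs_def] by (rule DERIV_diff[OF shift[OF fv] shift[OF fv]])
  obtain s where s: "0 < s" "s < h"
    "\<phi> h - \<phi> 0 = (h - 0) * (fv (x + h *\<^sub>R w + s *\<^sub>R v) - fv (x + s *\<^sub>R v))"
    using MVT2[OF \<open>0 < h\<close> \<phi>'] by metis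
  define \<kappa> where "\<kappa> t = fv (x + s *\<^sub>R v + t *\<^sub>R w)" for t
  have \<kappa>': "(\<kappa> has_real_derivative fvw (x + s *\<^sub>R v + t *\<^sub>R w)) (at t)" for t
    unfolding \<kappa>_def[abs_def] by (rule shift[OF fvw])
  obtain t where t: "0 < t" "t < h" "\<kappa> h - \<kappa> 0 = (h - 0) * fvw (x + s *\<^sub>R v + t *\<^sub>R w)"
    using MVT2[OF \<open>0 < h\<close> \<kappa>'] by metis
  show ?thesis
    using s t by (intro exI[of _ s] exI[of _ t]) (simp add: \<phi>_def \<kappa>_def algebra_simps)
qed

text \<open>
  The second difference is symmetric in \<open>v\<close> and \<open>w\<close>, so \<open>mean_value_second_difference\<close> gives points
  arbitrarily close to \<open>x\<close> at which the two mixed derivatives agree.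
\<close>

lemma mixed_partials_commute_real:
  fixes f :: "'a::real_normed_vector \<Rightarrow> real"
  assumes fv: "\<And>x. ((\<lambda>t. f (x + t *\<^sub>R v)) has_real_derivative fv x) (at 0)"
    and fw: "\<And>x. ((\<lambda>t. f (x + t *\<^sub>R w)) has_real_derivative fw x) (at 0)"
    and fvw: "\<And>x. ((\<lambda>t. fv (x + t *\<^sub>R w)) has_real_derivative fvw x) (at 0)"
    and fwv: "\<And>x. ((\<lambda>t. fw (x + t *\<^sub>R v)) has_real_derivative fwv x) (at 0)"
    and cont: "isCont fvw x" "isCont fwv x"
  shows "fvw x = fwv x"
proof -
  define h where "h m = 1 / real (Suc m)" for m
  have h: "0 < h m" for m by (simp add: h_def)
  have "\<exists>s t s' t'. 0 < s \<and> s < h m \<and> 0 < t \<and> t < h m \<and> 0 < s' \<and> s' < h m \<and> 0 < t' \<and> t' < h m \<and>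
      fvw (x + s *\<^sub>R v + t *\<^sub>R w) = fwv (x + s' *\<^sub>R w + t' *\<^sub>R v)" for m
    using mean_value_second_difference[OF fv fvw h[of m], of x]
      mean_value_second_difference[OF fw fwv h[of m], of x] h[of m]
    by (auto simp: algebra_simps) metis
  then obtain s t s' t' where st: "\<And>m. 0 < s m" "\<And>m. s m < h m" "\<And>m. 0 < t m" "\<And>m. t m < h m"
      "\<And>m. 0 < s' m" "\<And>m. s' m < h m" "\<And>m. 0 < t' m" "\<And>m. t' m < h m"
    and eq: "\<And>m. fvw (x + s m *\<^sub>R v + t m *\<^sub>R w) = fwv (x + s' m *\<^sub>R w + t' m *\<^sub>R v)"
    by metis
  have h0: "h \<longlonglongrightarrow> 0"
    unfolding h_def using LIMSEQ_inverse_real_of_nat by (simp add: inverse_eq_divide)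
  have to0: "u \<longlonglongrightarrow> 0" if "\<And>m. 0 < u m" "\<And>m. u m < h m" for u :: "nat \<Rightarrow> real"
    using that by (intro tendsto_sandwich[OF _ _ tendsto_const h0]) (auto intro!: always_eventually less_imp_le)
  have "(\<lambda>m. x + s m *\<^sub>R v + t m *\<^sub>R w) \<longlonglongrightarrow> x + 0 *\<^sub>R v + 0 *\<^sub>R w"
       "(\<lambda>m. x + s' m *\<^sub>R w + t' m *\<^sub>R v) \<longlonglongrightarrow> x + 0 *\<^sub>R w + 0 *\<^sub>R v"
    by (intro tendsto_intros to0 st)+
  then have "(\<lambda>m. fvw (x + s m *\<^sub>R v + t m *\<^sub>R w)) \<longlonglongrightarrow> fvw x"
       "(\<lambda>m. fwv (x + s' m *\<^sub>R w + t' m *\<^sub>R v)) \<longlonglongrightarrow> fwv x"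
    using cont by (auto intro: isCont_tendsto_compose)
  then show ?thesis
    unfolding eq by (rule LIMSEQ_unique)
qed

lemma has_real_derivative_along_line:
  fixes f :: "'a::real_normed_vector \<Rightarrow> real"
  assumes "(f has_derivative f') (at x)"
  shows "((\<lambda>t. f (x + t *\<^sub>R v)) has_real_derivative f' v) (at 0)"
proof -
  have "((\<lambda>t. x + t *\<^sub>R v) has_derivative (\<lambda>t. t *\<^sub>R v)) (at 0)"
    by (auto intro!: derivative_eq_intros)
  then have "((\<lambda>t. f (x + t *\<^sub>R v)) has_derivative (\<lambda>t. f' (t *\<^sub>R v))) (at 0)"
    by (rule has_derivative_compose) (use assms in simp)
  then show ?thesis
    using linear_cmul[OF has_derivative_linear[OF assms], of _ v]
    by (simp add: has_field_derivative_def mult.commute[of _ "f' v"])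
qed

text \<open>
  Reduced to the real case by pairing with an arbitrary vector.
\<close>

lemma frechet_derivatives_commute:
  fixes f :: "'a::real_normed_vector \<Rightarrow> 'b::real_inner"
  assumes f: "\<And>x. f differentiable at x"
    and fv: "\<And>x. (\<lambda>y. frechet_derivative f (at y) v) differentiable at x"
    and fw: "\<And>x. (\<lambda>y. frechet_derivative f (at y) w) differentiable at x"
    and cvw: "isCont (\<lambda>x. frechet_derivative (\<lambda>y. frechet_derivative f (at y) v) (at x) w) x"
    and cwv: "isCont (\<lambda>x. frechet_derivative (\<lambda>y. frechet_derivative f (at y) w) (at x) v) x"
  shows "frechet_derivative (\<lambda>y. frechet_derivative f (at y) v) (at x) w
    = frechet_derivative (\<lambda>y. frechet_derivative f (at y) w) (at x) v"
proof (rule vector_eq_rdot[THEN iffD1], rule allI)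
  fix z
  have line: "((\<lambda>t. g (x + t *\<^sub>R u) \<bullet> z) has_real_derivative frechet_derivative g (at x) u \<bullet> z) (at 0)"
    if "g differentiable at x" for g :: "'a \<Rightarrow> 'b" and x u
  proof (rule has_real_derivative_along_line)
    show "((\<lambda>y. g y \<bullet> z) has_derivative (\<lambda>h. frechet_derivative g (at x) h \<bullet> z)) (at x)"
      using that by (auto intro!: derivative_eq_intros simp: frechet_derivative_works)
  qed
  show "frechet_derivative (\<lambda>y. frechet_derivative f (at y) v) (at x) w \<bullet> z
    = frechet_derivative (\<lambda>y. frechet_derivative f (at y) w) (at x) v \<bullet> z"
    by (rule mixed_partials_commute_real[where f = "\<lambda>x. f x \<bullet> z" and v = v and w = w
          and fv = "\<lambda>x. frechet_derivative f (at x) v \<bullet> z" and fw = "\<lambda>x. frechet_derivative f (at x) w \<bullet> z"])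
       (intro line f fv fw continuous_intros cvw cwv)+
qed

section \<open>The conserved current\<close>

lemma smooth_frechet_derivative:
  "smooth f \<Longrightarrow> smooth (\<lambda>x. frechet_derivative f (at x) v)"
  unfolding smooth_def by (metis C_diff.simps(2))

lemma smooth_differentiable: "smooth f \<Longrightarrow> f differentiable at x"
  unfolding smooth_def by (metis C_diff.simps(2) UNIV_I differentiable_on_def)

lemma smooth_has_derivative: "smooth f \<Longrightarrow> (f has_derivative frechet_derivative f (at x)) (at x)"
  using smooth_differentiable frechet_derivative_works by blast

lemma smooth_continuous_on: "smooth f \<Longrightarrow> continuous_on A f"
  unfolding smooth_def by (metis C_diff.simps(1) continuous_on_subset subset_UNIV)

lemma nabla_eq_sum_Basis:
  assumes "smooth \<psi>"
  shows "nabla v \<psi> x = (\<Sum>b\<in>Basis. (v \<bullet> b) *\<^sub>R nabla b \<psi> x)"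
proof -
  have lin: "linear (frechet_derivative \<psi> (at x))"
    using smooth_has_derivative[OF assms] by (rule has_derivative_linear)
  show ?thesis
    unfolding nabla_def
    by (subst (1) euclidean_representation[of v, symmetric]) (simp only: linear_sum[OF lin] linear_cmul[OF lin])
qed

lemma smooth_nabla: "smooth \<psi> \<Longrightarrow> smooth (nabla v \<psi>)"
  unfolding nabla_def[abs_def] by (rule smooth_frechet_derivative)

lemma nabla_commute:
  assumes "smooth \<psi>"
  shows "nabla w (nabla v \<psi>) x = nabla v (nabla w \<psi>) x"
proof -
  have cont: "isCont (nabla b (nabla a \<psi>)) x" for a b x
    using smooth_continuous_on[OF smooth_nabla[OF smooth_nabla[OF assms]], of UNIV]
    by (simp add: continuous_on_eq_continuous_at)
  show ?thesis
    using frechet_derivatives_commute[of \<psi> v w x] smooth_differentiable[OF assms]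
      smooth_differentiable[OF smooth_nabla[OF assms]] cont
    by (simp add: nabla_def[abs_def])
qed

lemma has_derivative_matrix_vector_mult [derivative_intros]:
  fixes A :: "complex^'s^'s"
  assumes "(f has_derivative f') F"
  shows "((\<lambda>x. A *v f x) has_derivative (\<lambda>h. A *v f' h)) F"
  by (rule bounded_linear.has_derivative[OF matrix_vector_mul_bounded_linear assms])

lemma continuous_on_matrix_vector_mult [continuous_intros]:
  fixes A :: "complex^'s^'s"
  assumes "continuous_on X f"
  shows "continuous_on X (\<lambda>x. A *v f x)"
  by (rule bounded_linear.continuous_on[OF matrix_vector_mul_bounded_linear assms])

lemma linear_matrix_vector_mult: "linear ((*v) (A :: complex^'s^'s))"
  by (rule bounded_linear.linear[OF matrix_vector_mul_bounded_linear])

lemma clifford_mult_eq_sum_Basis: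
  fixes c :: "real^'n \<Rightarrow> complex^'s^'s"
  assumes "linear c"
  shows "c X *v \<phi> = (\<Sum>b\<in>Basis. (X \<bullet> b) *\<^sub>R (c b *v \<phi>))"
proof -
  have "linear (\<lambda>A :: complex^'s^'s. A *v \<phi>)"
    by (rule linearI) (simp_all add: matrix_vector_mult_def vec_eq_iff sum.distrib distrib_right scaleR_sum_right)
  then have lin: "linear (\<lambda>X. c X *v \<phi>)"
    using linear_compose[OF assms] by (simp add: o_def)
  show ?thesis
    by (subst (1) euclidean_representation[of X, symmetric]) (simp only: linear_sum[OF lin] linear_cmul[OF lin])
qed

text \<open>
  The component in direction \<open>e\<close> of the energy-momentum tensor contracted with the position field
  \<open>x - x0\<close>.
\<close>

definition momentum_current ::
  "(real^'n \<Rightarrow> complex^'s^'s) \<Rightarrow> (real^'n \<Rightarrow> complex^'s) \<Rightarrow> real \<Rightarrow> real^'n \<Rightarrow> real^'n \<Rightarrow> real^'n \<Rightarrow> real" where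
  "momentum_current c \<psi> mu x0 e x =
    \<psi> x \<bullet> (c e *v nabla (x - x0) \<psi> x) - mu / 2 * (((x - x0) \<bullet> e) * (\<psi> x \<bullet> \<psi> x)\<^sup>2)"

text \<open>
  The derivative of \<open>momentum_current c \<psi> mu x0 e\<close> at \<open>x\<close> in direction \<open>h\<close>.  The first summand inside
  the Clifford product comes from differentiating the position field.
\<close>

definition momentum_current_deriv ::
  "(real^'n \<Rightarrow> complex^'s^'s) \<Rightarrow> (real^'n \<Rightarrow> complex^'s) \<Rightarrow> real \<Rightarrow> real^'n \<Rightarrow> real^'n \<Rightarrow> real^'n \<Rightarrow> real^'n \<Rightarrow> real" where
  "momentum_current_deriv c \<psi> mu x0 e x h =
    nabla h \<psi> x \<bullet> (c e *v nabla (x - x0) \<psi> x)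
      + \<psi> x \<bullet> (c e *v (nabla h \<psi> x + (\<Sum>b\<in>Basis. ((x - x0) \<bullet> b) *\<^sub>R nabla h (nabla b \<psi>) x)))
      - mu / 2 * ((h \<bullet> e) * (\<psi> x \<bullet> \<psi> x)\<^sup>2 + ((x - x0) \<bullet> e) * (4 * (\<psi> x \<bullet> \<psi> x) * (\<psi> x \<bullet> nabla h \<psi> x)))"

lemma has_derivative_nabla:
  "smooth \<psi> \<Longrightarrow> (\<psi> has_derivative (\<lambda>h. nabla h \<psi> x)) (at x)"
  unfolding nabla_def[abs_def] by (rule smooth_has_derivative)

lemma has_derivative_momentum_current:
  fixes \<psi> :: "real^'n \<Rightarrow> complex^'s"
  assumes "smooth \<psi>"
  shows "(momentum_current c \<psi> mu x0 e has_derivative momentum_current_deriv c \<psi> mu x0 e x) (at x)"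
proof -
  note D = has_derivative_nabla[OF assms] has_derivative_nabla[OF smooth_nabla[OF assms]]
  have nab: "(\<lambda>x. nabla (x - x0) \<psi> x) = (\<lambda>x. \<Sum>b\<in>Basis. ((x - x0) \<bullet> b) *\<^sub>R nabla b \<psi> x)"
    by (rule ext) (rule nabla_eq_sum_Basis[OF assms])
  have "((\<lambda>x. \<Sum>b\<in>Basis. ((x - x0) \<bullet> b) *\<^sub>R nabla b \<psi> x) has_derivative
      (\<lambda>h. \<Sum>b\<in>Basis. ((x - x0) \<bullet> b) *\<^sub>R nabla h (nabla b \<psi>) x + (h \<bullet> b) *\<^sub>R nabla b \<psi> x)) (at x)"
    by (intro derivative_eq_intros refl) (auto intro: D)
  then have E: "((\<lambda>x. nabla (x - x0) \<psi> x) has_derivative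
      (\<lambda>h. nabla h \<psi> x + (\<Sum>b\<in>Basis. ((x - x0) \<bullet> b) *\<^sub>R nabla h (nabla b \<psi>) x))) (at x)"
    by (simp add: nab sum.distrib add.commute nabla_eq_sum_Basis[OF assms, of _ x, symmetric])
  show ?thesis
    unfolding momentum_current_def[abs_def] momentum_current_deriv_def[abs_def]
    by (rule derivative_eq_intros D E refl)+
       (auto simp: fun_eq_iff inner_commute algebra_simps power2_eq_square)
qed

lemma continuous_on_momentum_current_deriv:
  fixes \<psi> :: "real^'n \<Rightarrow> complex^'s"
  assumes "smooth \<psi>"
  shows "continuous_on A (\<lambda>x. momentum_current_deriv c \<psi> mu x0 e x h)"
proof -
  note C = smooth_continuous_on[OF assms] smooth_continuous_on[OF smooth_nabla[OF assms]]
    smooth_continuous_on[OF smooth_nabla[OF smooth_nabla[OF assms]]]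
  have "continuous_on A (\<lambda>x. nabla (x - x0) \<psi> x)"
    by (subst nabla_eq_sum_Basis[OF assms]) (intro continuous_intros C)
  then show ?thesis
    unfolding momentum_current_deriv_def by (intro continuous_intros C)
qed

text \<open>
  The divergence of the contracted tensor is its trace: all terms that contain the derivative \<open>E\<close> of
  \<open>\<psi>\<close> along \<open>x - x0\<close> cancel.  Skew-symmetry turns the first term into \<open>- Dirac \<psi> \<bullet> E\<close>, the terms with
  second derivatives are the derivative of the equation along \<open>x - x0\<close>, and the potential term
  contributes \<open>- 2 \<mu> |\<psi>|^2 \<psi> \<bullet> E\<close>.
\<close>

lemma momentum_current_divergence:
  fixes c :: "real^'n \<Rightarrow> complex^'s^'s"
  assumes skew: "\<And>X \<phi> \<xi>. (c X *v \<phi>) \<bullet> \<xi> = - (\<phi> \<bullet> (c X *v \<xi>))"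
    and \<psi>: "smooth \<psi>"
    and Dirac: "\<And>x. Dirac c \<psi> x = lam *\<^sub>R \<psi> x + (mu * (norm (\<psi> x))\<^sup>2) *\<^sub>R \<psi> x"
  shows "(\<Sum>e\<in>Basis. momentum_current_deriv c \<psi> mu x0 e x e)
    = lam * (norm (\<psi> x))\<^sup>2 + mu * (1 - real CARD('n) / 2) * norm (\<psi> x) ^ 4"
proof -
  note D = has_derivative_nabla[OF \<psi>] has_derivative_nabla[OF smooth_nabla[OF \<psi>]]
  define X where "X = x - x0"
  define N where "N = \<psi> x \<bullet> \<psi> x"
  define E where "E = nabla X \<psi> x"
  have E: "E = (\<Sum>b\<in>Basis. (X \<bullet> b) *\<^sub>R nabla b \<psi> x)"
    unfolding E_def by (rule nabla_eq_sum_Basis[OF \<psi>])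
  have Dirac_x: "Dirac c \<psi> x = (lam + mu * N) *\<^sub>R \<psi> x"
    by (simp add: Dirac N_def power2_norm_eq_inner scaleR_add_left)
  have T1: "(\<Sum>e\<in>Basis. nabla e \<psi> x \<bullet> (c e *v E)) = - ((lam + mu * N) * (\<psi> x \<bullet> E))"
  proof -
    have "(\<Sum>e\<in>Basis. nabla e \<psi> x \<bullet> (c e *v E)) = - (Dirac c \<psi> x \<bullet> E)"
      by (simp add: Dirac_def inner_sum_left skew sum_negf)
    then show ?thesis by (simp add: Dirac_x)
  qed
  have T2: "(\<Sum>e\<in>Basis. \<psi> x \<bullet> (c e *v nabla e \<psi> x)) = (lam + mu * N) * N"
  proof -
    have "(\<Sum>e\<in>Basis. \<psi> x \<bullet> (c e *v nabla e \<psi> x)) = \<psi> x \<bullet> Dirac c \<psi> x"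
      by (simp add: Dirac_def inner_sum_right)
    then show ?thesis by (simp add: Dirac_x N_def)
  qed
  \<comment> \<open>the equation differentiated in direction \<open>b\<close>\<close>
  have dDirac: "(\<Sum>e\<in>Basis. c e *v nabla e (nabla b \<psi>) x)
      = (lam + mu * N) *\<^sub>R nabla b \<psi> x + (2 * mu * (\<psi> x \<bullet> nabla b \<psi> x)) *\<^sub>R \<psi> x" for b
  proof -
    have "((\<lambda>y. Dirac c \<psi> y) has_derivative (\<lambda>h. \<Sum>e\<in>Basis. c e *v nabla h (nabla e \<psi>) x)) (at x)"
      unfolding Dirac_def by (intro derivative_intros) (auto intro: D)
    moreover have "((\<lambda>y. Dirac c \<psi> y) has_derivative
        (\<lambda>h. (lam + mu * N) *\<^sub>R nabla h \<psi> x + (2 * mu * (\<psi> x \<bullet> nabla h \<psi> x)) *\<^sub>R \<psi> x)) (at x)"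
      unfolding Dirac power2_norm_eq_inner
      by (rule derivative_eq_intros D(1) refl)+
         (auto simp: fun_eq_iff N_def inner_commute algebra_simps)
    ultimately have "(\<lambda>h. \<Sum>e\<in>Basis. c e *v nabla h (nabla e \<psi>) x)
        = (\<lambda>h. (lam + mu * N) *\<^sub>R nabla h \<psi> x + (2 * mu * (\<psi> x \<bullet> nabla h \<psi> x)) *\<^sub>R \<psi> x)"
      by (rule has_derivative_unique)
    then show ?thesis
      by (subst nabla_commute[OF \<psi>]) (rule fun_cong)
  qed
  have T3: "(\<Sum>e\<in>Basis. \<psi> x \<bullet> (c e *v (\<Sum>b\<in>Basis. (X \<bullet> b) *\<^sub>R nabla e (nabla b \<psi>) x)))
      = (lam + 3 * mu * N) * (\<psi> x \<bullet> E)"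
  proof -
    note lin = linear_matrix_vector_mult
    have "(\<Sum>e\<in>Basis. \<psi> x \<bullet> (c e *v (\<Sum>b\<in>Basis. (X \<bullet> b) *\<^sub>R nabla e (nabla b \<psi>) x)))
        = (\<Sum>e\<in>Basis. \<Sum>b\<in>Basis. (X \<bullet> b) * (\<psi> x \<bullet> (c e *v nabla e (nabla b \<psi>) x)))"
      by (simp only: linear_sum[OF lin] linear_cmul[OF lin] inner_sum_right inner_scaleR_right)
    also have "\<dots> = (\<Sum>b\<in>Basis. (X \<bullet> b) * (\<psi> x \<bullet> (\<Sum>e\<in>Basis. c e *v nabla e (nabla b \<psi>) x)))"
      by (subst sum.swap) (simp add: inner_sum_right sum_distrib_left)
    also have "\<dots> = (\<Sum>b\<in>Basis. (X \<bullet> b) * ((lam + 3 * mu * N) * (\<psi> x \<bullet> nabla b \<psi> x)))"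
      unfolding dDirac by (simp add: inner_add_right N_def algebra_simps)
    also have "\<dots> = (lam + 3 * mu * N) * (\<psi> x \<bullet> E)"
      by (simp add: E inner_sum_right sum_distrib_left mult_ac)
    finally show ?thesis .
  qed
  have T4: "(\<Sum>e\<in>(Basis :: (real^'n) set). (e \<bullet> e) * N\<^sup>2) = real CARD('n) * N\<^sup>2"
    by simp
  have T5: "(\<Sum>e\<in>Basis. (X \<bullet> e) * (4 * N * (\<psi> x \<bullet> nabla e \<psi> x))) = 4 * N * (\<psi> x \<bullet> E)"
    by (simp add: E inner_sum_right sum_distrib_left mult_ac)
  have "(\<Sum>e\<in>Basis. momentum_current_deriv c \<psi> mu x0 e x e)
      = (\<Sum>e\<in>Basis. nabla e \<psi> x \<bullet> (c e *v E))
        + ((\<Sum>e\<in>Basis. \<psi> x \<bullet> (c e *v nabla e \<psi> x))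
          + (\<Sum>e\<in>Basis. \<psi> x \<bullet> (c e *v (\<Sum>b\<in>Basis. (X \<bullet> b) *\<^sub>R nabla e (nabla b \<psi>) x))))
        - mu / 2 * ((\<Sum>e\<in>(Basis :: (real^'n) set). (e \<bullet> e) * N\<^sup>2)
          + (\<Sum>e\<in>Basis. (X \<bullet> e) * (4 * N * (\<psi> x \<bullet> nabla e \<psi> x))))"
    unfolding momentum_current_deriv_def X_def[symmetric] N_def[symmetric] E_def[symmetric]
    by (simp only: linear_add[OF linear_matrix_vector_mult] inner_add_right sum.distrib sum_subtractf
        sum_distrib_left[symmetric])
  also have "\<dots> = lam * N + mu * (1 - real CARD('n) / 2) * N\<^sup>2"
    unfolding T1 T2 T3 T4 T5 by (simp add: algebra_simps power2_eq_square)
  also have "N\<^sup>2 = norm (\<psi> x) ^ 4"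
    by (simp add: N_def power2_norm_eq_inner[symmetric])
  finally show ?thesis by (simp add: N_def power2_norm_eq_inner)
qed

lemma momentum_current_radial:
  fixes c :: "real^'n \<Rightarrow> complex^'s^'s"
  assumes "linear c"
  shows "(\<Sum>e\<in>Basis. ((x - x0) \<bullet> e) * momentum_current c \<psi> mu x0 e x)
    = \<psi> x \<bullet> (c (x - x0) *v nabla (x - x0) \<psi> x) - mu / 2 * (dist x x0)\<^sup>2 * norm (\<psi> x) ^ 4"
proof -
  have "(\<Sum>e\<in>Basis. ((x - x0) \<bullet> e) * momentum_current c \<psi> mu x0 e x)
      = (\<Sum>e\<in>Basis. ((x - x0) \<bullet> e) * (\<psi> x \<bullet> (c e *v nabla (x - x0) \<psi> x)))
        - mu / 2 * ((\<Sum>e\<in>Basis. ((x - x0) \<bullet> e) * ((x - x0) \<bullet> e)) * (\<psi> x \<bullet> \<psi> x)\<^sup>2)"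
    by (simp add: momentum_current_def right_diff_distrib sum_subtractf sum_distrib_left sum_distrib_right mult_ac)
  also have "(\<Sum>e\<in>Basis. ((x - x0) \<bullet> e) * ((x - x0) \<bullet> e)) = (dist x x0)\<^sup>2"
    by (simp add: dist_norm power2_norm_eq_inner euclidean_inner[of "x - x0" "x - x0"])
  also have "(\<psi> x \<bullet> \<psi> x)\<^sup>2 = norm (\<psi> x) ^ 4"
    by (simp add: power2_norm_eq_inner[symmetric])
  also have "(\<Sum>e\<in>Basis. ((x - x0) \<bullet> e) * (\<psi> x \<bullet> (c e *v nabla (x - x0) \<psi> x)))
      = \<psi> x \<bullet> (c (x - x0) *v nabla (x - x0) \<psi> x)"
    unfolding clifford_mult_eq_sum_Basis[OF assms, of "x - x0"] by (simp add: inner_sum_right)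
  finally show ?thesis by simp
qed

lemma inner_radial_field:
  fixes c :: "real^'n \<Rightarrow> complex^'s^'s"
  assumes "linear c" "smooth \<psi>"
  shows "\<psi> x \<bullet> (c (radial_field x0 x) *v nabla (radial_field x0 x) \<psi> x)
    = \<psi> x \<bullet> (c (x - x0) *v nabla (x - x0) \<psi> x) / (dist x x0)\<^sup>2"
proof -
  have "nabla (a *\<^sub>R v) \<psi> x = a *\<^sub>R nabla v \<psi> x" for a v
    unfolding nabla_def
    by (rule linear_cmul[OF has_derivative_linear[OF smooth_has_derivative[OF assms(2)]]])
  moreover have "c (a *\<^sub>R v) *v \<phi> = a *\<^sub>R (c v *v \<phi>)" for a v and \<phi> :: "complex^'s"
    unfolding clifford_mult_eq_sum_Basis[OF assms(1), of "a *\<^sub>R v"] clifford_mult_eq_sum_Basis[OF assms(1), of v]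
    by (simp add: scaleR_sum_right)
  ultimately show ?thesis
    by (simp add: radial_field_def linear_cmul[OF linear_matrix_vector_mult] power2_eq_square divide_inverse)
qed

section \<open>Radial cutoffs\<close>

text \<open>
  If \<open>P\<close> is an antiderivative of \<open>p\<close>, this is the integral of \<open>p\<close> over the radii in \<open>[R1, R2]\<close> that
  exceed the distance from \<open>x0\<close>.
\<close>

definition radial_cutoff :: "(real \<Rightarrow> real) \<Rightarrow> real \<Rightarrow> real \<Rightarrow> 'a::metric_space \<Rightarrow> 'a \<Rightarrow> real" where
  "radial_cutoff P R1 R2 x0 x = P R2 - P (max R1 (min R2 (dist x x0)))"

lemma AE_lborel_dist_neq: "AE x in (lborel :: 'a::euclidean_space measure). dist x x0 \<noteq> r"
proof -
  have "sphere x0 r \<in> null_sets (lborel :: 'a measure)"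
    using negligible_sphere[of x0 r] by (simp add: negligible_iff_null_sets null_sets_completion_iff)
  from AE_not_in[OF this] show ?thesis
    by eventually_elim (simp add: dist_commute)
qed

locale radial_weight =
  fixes P p :: "real \<Rightarrow> real" and R1 R2 :: real
  assumes R: "R1 < R2"
    and deriv: "\<And>s. R1 \<le> s \<Longrightarrow> s \<le> R2 \<Longrightarrow> (P has_real_derivative p s) (at s)"
    and cont: "\<And>s. R1 \<le> s \<Longrightarrow> s \<le> R2 \<Longrightarrow> isCont p s"
    and measurable_weight [measurable]: "p \<in> borel_measurable borel"
begin

lemma weight_bounded: "\<exists>B\<ge>0. \<forall>s\<in>{R1..R2}. \<bar>p s\<bar> \<le> B"
proof -
  have "bounded (p ` {R1..R2})"
    using cont by (intro compact_imp_bounded compact_continuous_image continuous_at_imp_continuous_on) auto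
  then obtain B where "\<forall>s\<in>{R1..R2}. \<bar>p s\<bar> \<le> B" by (auto simp: bounded_iff)
  then show ?thesis by (intro exI[of _ "\<bar>B\<bar>"]) (auto intro: order_trans[OF _ abs_ge_self])
qed

lemma radial_cutoff_lipschitz: "\<exists>L. L-lipschitz_on UNIV (radial_cutoff P R1 R2 x0)"
proof -
  obtain B where B: "0 \<le> B" "\<And>s. s \<in> {R1..R2} \<Longrightarrow> \<bar>p s\<bar> \<le> B"
    using weight_bounded by blast
  let ?cl = "\<lambda>t. max R1 (min R2 t)"
  have "B-lipschitz_on UNIV (radial_cutoff P R1 R2 x0)"
  proof (rule lipschitz_onI)
    fix x y
    have "norm (P (?cl (dist x x0)) - P (?cl (dist y x0))) \<le> B * norm (?cl (dist x x0) - ?cl (dist y x0))"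
      by (rule field_differentiable_bound[of "{R1..R2}" P p])
         (use R deriv B in \<open>auto intro: has_field_derivative_at_within\<close>)
    also have "norm (?cl (dist x x0) - ?cl (dist y x0)) \<le> \<bar>dist x x0 - dist y x0\<bar>"
      by auto
    also have "\<dots> \<le> dist x y"
      using dist_triangle[of x x0 y] dist_triangle[of y x0 x] by (simp add: dist_commute abs_le_iff)
    finally show "dist (radial_cutoff P R1 R2 x0 x) (radial_cutoff P R1 R2 x0 y) \<le> B * dist x y"
      using B(1) by (simp add: radial_cutoff_def dist_real_def abs_minus_commute mult_left_mono)
  qed fact
  then show ?thesis ..
qed

lemma radial_cutoff_outside: "R2 < dist x0 x \<Longrightarrow> radial_cutoff P R1 R2 x0 x = 0"
  using R by (simp add: radial_cutoff_def dist_commute)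

lemma continuous_on_radial_cutoff: "continuous_on A (radial_cutoff P R1 R2 x0)"
  using radial_cutoff_lipschitz lipschitz_on_continuous_on continuous_on_subset by blast

lemma integrable_radial_cutoff:
  fixes h :: "'a::euclidean_space \<Rightarrow> real"
  assumes "continuous_on UNIV h"
  shows "integrable lborel (\<lambda>x. radial_cutoff P R1 R2 x0 x * h x)"
proof -
  have "integrable lborel (\<lambda>x. indicator (cball x0 R2) x *\<^sub>R (radial_cutoff P R1 R2 x0 x * h x))"
    by (intro borel_integrable_compact continuous_intros continuous_on_radial_cutoff
        continuous_on_subset[OF assms]) auto
  moreover have "indicator (cball x0 R2) x *\<^sub>R (radial_cutoff P R1 R2 x0 x * h x)
      = radial_cutoff P R1 R2 x0 x * h x" for x
    using radial_cutoff_outside[of x0 x] by (auto simp: indicator_def not_le)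
  ultimately show ?thesis by (simp only:)
qed

text \<open>
  The cutoff is constant inside the annulus and outside it; the two bounding spheres, where it has a
  kink, are excluded.
\<close>

lemma has_derivative_radial_cutoff:
  fixes x0 x :: "'a::euclidean_space"
  assumes "dist x x0 \<noteq> R1" "dist x x0 \<noteq> R2" "0 < R1"
  shows "(radial_cutoff P R1 R2 x0 has_derivative
    (\<lambda>v. - (indicator {R1..R2} (dist x x0) * p (dist x x0) / dist x x0 * ((x - x0) \<bullet> v)))) (at x)"
proof -
  consider "dist x x0 < R1" | "R1 < dist x x0" "dist x x0 < R2" | "R2 < dist x x0"
    using assms by linarith
  then show ?thesis
  proof cases
    case 1
    have "((\<lambda>x. P R2 - P R1) has_derivative (\<lambda>v. 0)) (at x)" by simp
    then have "(radial_cutoff P R1 R2 x0 has_derivative (\<lambda>v. 0)) (at x)"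
      by (rule has_derivative_transform_within_open[where s = "ball x0 R1"])
         (use 1 R in \<open>auto simp: radial_cutoff_def dist_commute\<close>)
    then show ?thesis using 1 by simp
  next
    case 2
    then have "x \<noteq> x0" using assms(3) by auto
    have "((\<lambda>y. dist y x0) has_derivative (\<lambda>v. v \<bullet> sgn (x - x0))) (at x)"
      unfolding dist_norm
      by (rule has_derivative_compose[where g = norm, OF _ has_derivative_norm, of _ "\<lambda>v. v", simplified])
         (use \<open>x \<noteq> x0\<close> in \<open>auto intro!: derivative_eq_intros\<close>)
    moreover have "(P has_derivative (\<lambda>t. t * p (dist x x0))) (at (dist x x0))"
      using deriv[of "dist x x0"] 2 by (simp add: has_field_derivative_def mult.commute[of _ "p (dist x x0)"])
    ultimately have "((\<lambda>y. P (dist y x0)) has_derivative (\<lambda>v. (v \<bullet> sgn (x - x0)) * p (dist x x0))) (at x)"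
      by (rule has_derivative_compose)
    then have "((\<lambda>y. P R2 - P (dist y x0)) has_derivative (\<lambda>v. - ((v \<bullet> sgn (x - x0)) * p (dist x x0)))) (at x)"
      by (auto intro!: derivative_eq_intros)
    then have "(radial_cutoff P R1 R2 x0 has_derivative (\<lambda>v. - ((v \<bullet> sgn (x - x0)) * p (dist x x0)))) (at x)"
      by (rule has_derivative_transform_within_open[where s = "{y. R1 < dist y x0 \<and> dist y x0 < R2}"])
         (use 2 in \<open>auto simp: radial_cutoff_def intro!: open_Collect_conj open_Collect_less continuous_intros\<close>)
    then show ?thesis
      using 2 by (simp add: sgn_div_norm dist_norm inner_commute divide_inverse mult_ac)
  next
    case 3
    have "((\<lambda>x. 0) has_derivative (\<lambda>v. 0)) (at x)" by simp
    then have "(radial_cutoff P R1 R2 x0 has_derivative (\<lambda>v. 0)) (at x)"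
      by (rule has_derivative_transform_within_open[where s = "- cball x0 R2"])
         (use 3 in \<open>auto simp: radial_cutoff_outside dist_commute not_le\<close>)
    then show ?thesis using 3 by simp
  qed
qed

text \<open>
  The cutoff at \<open>x\<close> is the integral of \<open>p s\<close> over those \<open>s\<close> in \<open>[R1, R2]\<close> with \<open>x\<close> in the ball of radius
  \<open>s\<close>; exchange the integrals.
\<close>

lemma integral_radial_cutoff:
  fixes h :: "'a::euclidean_space \<Rightarrow> real"
  assumes h: "continuous_on UNIV h"
  shows "(\<integral> x. radial_cutoff P R1 R2 x0 x * h x \<partial>lborel)
    = (LINT s:{R1..R2}|lborel. p s * (LINT x:ball x0 s|lborel. h x))"
proof -
  have [measurable]: "h \<in> borel_measurable borel" using h by (rule borel_measurable_continuous_onI)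
  define W where "W s x = indicator {R1..R2} s * p s * (indicator {x. dist x x0 < s} x * h x)" for s x
  obtain B where B: "0 \<le> B" "\<And>s. s \<in> {R1..R2} \<Longrightarrow> \<bar>p s\<bar> \<le> B"
    using weight_bounded by blast
  have "bounded (h ` cball x0 R2)"
    using continuous_on_subset[OF h] by (intro compact_imp_bounded compact_continuous_image) auto
  then obtain M where "\<forall>x\<in>cball x0 R2. \<bar>h x\<bar> \<le> M"
    unfolding bounded_iff ball_simps real_norm_def ..
  then have M: "\<bar>h x\<bar> \<le> M" if "x \<in> cball x0 R2" for x
    using that by (rule bspec)
  have int: "integrable (lborel \<Otimes>\<^sub>M lborel) (case_prod W)"
  proof (rule integrableI_bounded_set[where A = "{R1..R2} \<times> cball x0 R2" and B = "B * M"])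
    show "emeasure (lborel \<Otimes>\<^sub>M lborel) ({R1..R2} \<times> cball x0 R2) < \<infinity>"
      unfolding lborel_prod by (intro emeasure_bounded_finite bounded_Times) auto
    show "AE z in lborel \<Otimes>\<^sub>M lborel. z \<in> {R1..R2} \<times> cball x0 R2 \<longrightarrow> norm (case_prod W z) \<le> B * M"
    proof (intro AE_I2 impI)
      fix z assume z: "z \<in> {R1..R2} \<times> cball x0 R2"
      obtain s x where sx: "z = (s, x)" by fastforce
      have "\<bar>W s x\<bar> \<le> \<bar>p s\<bar> * \<bar>h x\<bar>"
        by (auto simp: W_def abs_mult indicator_def)
      also have "\<dots> \<le> B * M"
        using z B M by (intro mult_mono) (auto simp: sx)
      finally show "norm (case_prod W z) \<le> B * M" by (simp add: sx)
    qed
    show "AE z in lborel \<Otimes>\<^sub>M lborel. z \<notin> {R1..R2} \<times> cball x0 R2 \<longrightarrow> case_prod W z = 0"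
      by (intro AE_I2) (auto simp: W_def indicator_def dist_commute)
    show "case_prod W \<in> borel_measurable (lborel \<Otimes>\<^sub>M lborel)"
      unfolding W_def[abs_def] by measurable
  qed auto
  have inner: "(\<integral> s. W s x \<partial>lborel) = radial_cutoff P R1 R2 x0 x * h x" for x
  proof -
    let ?a = "max R1 (min R2 (dist x x0))"
    have "(\<integral> s. W s x \<partial>lborel) = (\<integral> s. (p s * indicator {?a..R2} s) * h x \<partial>lborel)"
    proof (rule integral_cong_AE)
      show "AE s in lborel. W s x = (p s * indicator {?a..R2} s) * h x"
        using AE_lborel_singleton[of "dist x x0"] AE_lborel_singleton[of R2]
        by eventually_elim (auto simp: W_def indicator_def)
    qed (simp_all add: W_def)
    also have "\<dots> = (\<integral> s. p s * indicator {?a..R2} s \<partial>lborel) * h x"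
      by simp
    also have "(\<integral> s. p s * indicator {?a..R2} s \<partial>lborel) = P R2 - P ?a"
      by (rule integral_FTC_Icc_real) (use R deriv cont in auto)
    finally show ?thesis by (simp add: radial_cutoff_def)
  qed
  have outer: "(\<integral> x. W s x \<partial>lborel) = indicator {R1..R2} s *\<^sub>R (p s * (LINT x:ball x0 s|lborel. h x))" for s
  proof -
    have "ball x0 s = {x. dist x x0 < s}" by (auto simp: dist_commute)
    then show ?thesis by (simp add: W_def set_lebesgue_integral_def)
  qed
  have "(\<integral> x. radial_cutoff P R1 R2 x0 x * h x \<partial>lborel) = (\<integral> x. \<integral> s. W s x \<partial>lborel \<partial>lborel)"
    by (simp add: inner)
  also have "\<dots> = (\<integral> s. \<integral> x. W s x \<partial>lborel \<partial>lborel)"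
    by (rule lborel_pair.Fubini_integral[OF int])
  finally show ?thesis
    by (simp add: outer set_lebesgue_integral_def)
qed

lemma integrable_annulus:
  fixes k :: "'a::euclidean_space \<Rightarrow> real"
  assumes "continuous_on {x. dist x x0 \<in> {R1..R2}} k"
  shows "integrable lborel (\<lambda>x. indicator {R1..R2} (dist x x0) * k x)"
proof -
  have "{x. dist x x0 \<in> {R1..R2}} = cball x0 R2 - ball x0 R1"
    by (auto simp: dist_commute)
  then have "compact {x. dist x x0 \<in> {R1..R2}}"
    by (simp add: compact_diff)
  from borel_integrable_compact[OF this assms]
  show ?thesis by (simp add: indicator_def)
qed

text \<open>
  For each \<open>e\<close> the product of the cutoff with \<open>S e\<close> is Lipschitz with compact support, so its
  derivative in direction \<open>e\<close> integrates to 0; the product rule and summation over \<open>e\<close> give the claim.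
\<close>

lemma integral_cutoff_divergence:
  fixes S :: "'a::euclidean_space \<Rightarrow> 'a \<Rightarrow> real"
  assumes S: "\<And>e x. (S e has_derivative S' e x) (at x)"
    and S': "\<And>e v. continuous_on UNIV (\<lambda>x. S' e x v)"
    and "0 < R1"
  shows "(\<integral> x. radial_cutoff P R1 R2 x0 x * (\<Sum>e\<in>Basis. S' e x e) \<partial>lborel)
    = (\<integral> x. indicator {R1..R2} (dist x x0) *
        (p (dist x x0) / dist x x0 * (\<Sum>e\<in>Basis. ((x - x0) \<bullet> e) * S e x)) \<partial>lborel)"
proof -
  let ?\<eta> = "radial_cutoff P R1 R2 x0"
  let ?k = "\<lambda>e x. p (dist x x0) / dist x x0 * (((x - x0) \<bullet> e) * S e x)"
  have contS: "continuous_on A (S e)" for A e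
    using S by (auto intro!: continuous_at_imp_continuous_on has_derivative_continuous)
  have "continuous_on {R1..R2} p"
    using cont by (auto intro: continuous_at_imp_continuous_on)
  then have "continuous_on {x. dist x x0 \<in> {R1..R2}} (\<lambda>x. p (dist x x0))"
    by (rule continuous_on_compose2) (auto intro!: continuous_intros)
  then have int2: "integrable lborel (\<lambda>x. indicator {R1..R2} (dist x x0) * ?k e x)" for e
    using \<open>0 < R1\<close> by (intro integrable_annulus continuous_intros contS) auto
  have int1: "integrable lborel (\<lambda>x. ?\<eta> x * S' e x e)" for e
    by (intro integrable_radial_cutoff S')
  have eq: "(\<integral> x. ?\<eta> x * S' e x e \<partial>lborel) = (\<integral> x. indicator {R1..R2} (dist x x0) * ?k e x \<partial>lborel)" for e
  proof -
    obtain K where K: "K-lipschitz_on UNIV ?\<eta>"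
      using radial_cutoff_lipschitz by blast
    obtain L where L: "\<And>x y. \<bar>?\<eta> x * S e x - ?\<eta> y * S e y\<bar> \<le> L * dist x y"
      using lipschitz_cutoff_times_C1[OF S S' K radial_cutoff_outside] by blast
    let ?g = "\<lambda>x. ?\<eta> x * S' e x e - indicator {R1..R2} (dist x x0) * ?k e x"
    have "AE x in lborel. ((\<lambda>t. ?\<eta> (x + t *\<^sub>R e) * S e (x + t *\<^sub>R e)) has_real_derivative ?g x) (at 0)"
      using AE_lborel_dist_neq[of x0 R1] AE_lborel_dist_neq[of x0 R2]
    proof eventually_elim
      case (elim x)
      from has_real_derivative_along_line[OF has_derivative_mult[OF
          has_derivative_radial_cutoff[OF elim \<open>0 < R1\<close>] S[of e]], of e]
      show ?case by (simp add: algebra_simps diff_divide_distrib)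
    qed
    moreover have "?g \<in> borel_measurable borel"
      using borel_measurable_integrable[OF int1] borel_measurable_integrable[OF int2] by simp
    ultimately have "(\<integral> x. ?g x \<partial>lborel) = 0"
      by (intro integral_directional_derivative_eq_0[where f = "\<lambda>x. ?\<eta> x * S e x" and L = L and r = R2 and a = x0 and v = e])
         (auto simp: L radial_cutoff_outside)
    then show ?thesis
      using int1 int2 by simp
  qed
  have "(\<integral> x. ?\<eta> x * (\<Sum>e\<in>Basis. S' e x e) \<partial>lborel) = (\<Sum>e\<in>Basis. \<integral> x. ?\<eta> x * S' e x e \<partial>lborel)"
    using int1 by (simp add: sum_distrib_left)
  also have "\<dots> = (\<integral> x. (\<Sum>e\<in>Basis. indicator {R1..R2} (dist x x0) * ?k e x) \<partial>lborel)"
    using int2 by (simp add: eq)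
  finally show ?thesis
    by (simp add: sum_distrib_left)
qed

end

section \<open>The monotonicity identity\<close>

lemma borel_measurable_power_int [measurable]: "(\<lambda>s :: real. s powi m) \<in> borel_measurable borel"
  unfolding power_int_def by (cases "0 \<le> m") auto

text \<open>
  The logarithm is the antiderivative needed in dimension 2.
\<close>

lemma antiderivative_power_int: "\<exists>P. \<forall>s>0. (P has_real_derivative s powi m) (at s)"
proof (cases "m = - 1")
  case True
  have "(ln has_real_derivative s powi m) (at s)" if "0 < s" for s
    using that by (auto intro!: derivative_eq_intros simp: True power_int_minus divide_inverse)
  then show ?thesis by blast
next
  case False
  have "((\<lambda>s. s powi (m + 1) / of_int (m + 1)) has_real_derivative s powi m) (at s)" if "0 < s" for s :: real
  proof -
    have "of_int (m + 1) \<noteq> (0 :: real)" using False by (simp only: of_int_eq_0_iff)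
    then show ?thesis
      using that by (auto intro!: derivative_eq_intros)
  qed
  then show ?thesis by blast
qed

theorem proposition4p5:
  fixes c :: "real^'n \<Rightarrow> complex^'s^'s"
    and \<psi> :: "real^'n \<Rightarrow> complex^'s"
    and x0 :: "real^'n"
    and lam mu R R1 R2 :: real
  assumes "spinor_clifford_mult c"
    and "smooth \<psi>"
    and "\<And>x. Dirac c \<psi> x = lam *\<^sub>R \<psi> x + (mu * (norm (\<psi> x))\<^sup>2) *\<^sub>R \<psi> x"
    and "0 < R1" and "R1 < R2" and "R2 \<le> R"
  shows
    "R2 powi (2 - int CARD('n)) * mu * (LINT x:ball x0 R2|lborel. norm (\<psi> x) ^ 4)
       - R1 powi (2 - int CARD('n)) * mu * (LINT x:ball x0 R1|lborel. norm (\<psi> x) ^ 4)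
     = - 2 * lam * (LINT r:{R1..R2}|lborel.
           r powi (1 - int CARD('n)) * (LINT x:ball x0 r|lborel. (norm (\<psi> x))\<^sup>2))
       + 2 * (LINT r:{R1..R2}|lborel.
           r powi (2 - int CARD('n)) *
             (LINT x|sphere_measure x0 r.
                \<psi> x \<bullet> (c (radial_field x0 x) *v nabla (radial_field x0 x) \<psi> x)))"
proof -
  let ?n = "int CARD('n)"
  define m where "m = 2 - ?n"
  have m1: "m - 1 = 1 - ?n" by (simp add: m_def)
  have lin: "linear c" and skew: "\<And>X \<phi> \<xi>. (c X *v \<phi>) \<bullet> \<xi> = - (\<phi> \<bullet> (c X *v \<xi>))"
    using assms(1) by (auto simp: spinor_clifford_mult_def)
  note \<psi> = \<open>smooth \<psi>\<close>
  have cont\<psi>: "continuous_on A \<psi>" for A by (rule smooth_continuous_on[OF \<psi>])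
  define N where "N x = (norm (\<psi> x))\<^sup>2" for x
  define Q where "Q x = norm (\<psi> x) ^ 4" for x
  define f where "f x = \<psi> x \<bullet> (c (radial_field x0 x) *v nabla (radial_field x0 x) \<psi> x)" for x
  have cN: "continuous_on A N" and cQ: "continuous_on A Q" for A
    unfolding N_def Q_def by (intro continuous_intros cont\<psi>)+
  have cE: "continuous_on A (\<lambda>x. \<psi> x \<bullet> (c (x - x0) *v nabla (x - x0) \<psi> x))" for A
    by (simp only: clifford_mult_eq_sum_Basis[OF lin, of "_ - x0"] nabla_eq_sum_Basis[OF \<psi>, of "_ - x0"])
       (intro continuous_intros cont\<psi> smooth_continuous_on[OF smooth_nabla[OF \<psi>]])
  have f: "f = (\<lambda>x. \<psi> x \<bullet> (c (x - x0) *v nabla (x - x0) \<psi> x) / (dist x x0)\<^sup>2)"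
    by (simp add: fun_eq_iff f_def inner_radial_field[OF lin \<psi>])
  have [measurable]: "f \<in> borel_measurable borel"
    unfolding f by (intro borel_measurable_divide borel_measurable_continuous_onI cE continuous_intros)
  have powi_cont: "isCont (\<lambda>s. s powi k) s" if "0 < s" for s :: real and k
    using that by (auto intro!: continuous_intros)
  obtain P where P: "\<And>s. 0 < s \<Longrightarrow> (P has_real_derivative s powi (1 - ?n)) (at s)"
    using antiderivative_power_int by blast
  \<comment> \<open>the weight of the integrated divergence theorem\<close>
  interpret cut: radial_weight P "\<lambda>s. s powi (1 - ?n)" R1 R2
    using assms P powi_cont by unfold_locales auto
  \<comment> \<open>the same weight times \<open>2 - n\<close>, with the explicit antiderivative that yields the boundary terms\<close>
  interpret pow: radial_weight "\<lambda>s. s powi m" "\<lambda>s. of_int m * s powi (1 - ?n)" R1 R2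
  proof
    fix s assume "R1 \<le> s" "s \<le> R2"
    then have "0 < s" using assms by linarith
    then show "((\<lambda>s. s powi m) has_real_derivative of_int m * s powi (1 - ?n)) (at s)"
      by (auto intro!: derivative_eq_intros simp flip: m1)
    show "isCont (\<lambda>s. of_int m * s powi (1 - ?n)) s"
      by (intro isCont_mult continuous_const powi_cont \<open>0 < s\<close>)
  qed (use assms in auto)
  let ?A = "\<lambda>x. indicator {R1..R2} (dist x x0) :: real"
  have powi_ann: "continuous_on {x. dist x x0 \<in> {R1..R2}} (\<lambda>x. dist x x0 powi k)" for k
    using assms by (auto intro!: continuous_intros)
  \<comment> \<open>\<open>I\<close> and \<open>J\<close> are the two parts of the flux term, \<open>a\<close> and \<open>b\<close> the averaged ball integrals\<close>
  define I where "I = (\<integral> x. ?A x * (dist x x0 powi m * f x) \<partial>lborel)"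
  define J where "J = (\<integral> x. ?A x * (dist x x0 powi m * Q x) \<partial>lborel)"
  have intI: "integrable lborel (\<lambda>x. ?A x * (dist x x0 powi m * f x))"
    unfolding f using assms by (intro cut.integrable_annulus continuous_intros powi_ann cE) auto
  have intJ: "integrable lborel (\<lambda>x. ?A x * (dist x x0 powi m * Q x))"
    by (intro cut.integrable_annulus continuous_intros powi_ann cQ)
  define a where "a = (LINT r:{R1..R2}|lborel. r powi (1 - ?n) * (LINT x:ball x0 r|lborel. N x))"
  define b where "b = (LINT r:{R1..R2}|lborel. r powi (1 - ?n) * (LINT x:ball x0 r|lborel. Q x))"
  define G where "G r = (LINT x:ball x0 r|lborel. Q x)" for r
  have polar: "I = (LINT r:{R1..R2}|lborel. r powi m * (LINT x|sphere_measure x0 r. f x))"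
    unfolding I_def using integral_annulus_polar[of R1 f "\<lambda>s. s powi m" R2 x0] intI assms
    by (simp add: mult.assoc)
  have balance: "lam * a + mu * (1 - real CARD('n) / 2) * b = I - mu / 2 * J"
  proof -
    let ?\<eta> = "radial_cutoff P R1 R2 x0"
    have "lam * a + mu * (1 - real CARD('n) / 2) * b
        = (\<integral> x. lam * (?\<eta> x * N x) + mu * (1 - real CARD('n) / 2) * (?\<eta> x * Q x) \<partial>lborel)"
      using cut.integrable_radial_cutoff[OF cN] cut.integrable_radial_cutoff[OF cQ]
      by (simp add: a_def b_def cut.integral_radial_cutoff[OF cN, symmetric] cut.integral_radial_cutoff[OF cQ, symmetric])
    also have "\<dots> = (\<integral> x. ?\<eta> x * (\<Sum>e\<in>Basis. momentum_current_deriv c \<psi> mu x0 e x e) \<partial>lborel)"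
      unfolding momentum_current_divergence[OF skew \<psi> assms(3)] N_def Q_def
      by (intro Bochner_Integration.integral_cong) (simp_all add: algebra_simps)
    also have "\<dots> = (\<integral> x. ?A x * (dist x x0 powi (1 - ?n) / dist x x0 *
          (\<Sum>e\<in>Basis. ((x - x0) \<bullet> e) * momentum_current c \<psi> mu x0 e x)) \<partial>lborel)"
      by (intro cut.integral_cutoff_divergence has_derivative_momentum_current
          continuous_on_momentum_current_deriv \<psi> assms)
    also have "\<dots> = (\<integral> x. ?A x * (dist x x0 powi m * f x) - mu / 2 * (?A x * (dist x x0 powi m * Q x)) \<partial>lborel)"
    proof (intro Bochner_Integration.integral_cong refl)
      fix x
      \<comment> \<open>the unit radial field occurs twice in \<open>f\<close>, which accounts for the two factors of the distance\<close>
      show "?A x * (dist x x0 powi (1 - ?n) / dist x x0 * (\<Sum>e\<in>Basis. ((x - x0) \<bullet> e) * momentum_current c \<psi> mu x0 e x))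
          = ?A x * (dist x x0 powi m * f x) - mu / 2 * (?A x * (dist x x0 powi m * Q x))"
      proof (cases "dist x x0 \<in> {R1..R2}")
        case True
        then have pos: "0 < dist x x0" using assms by auto
        have "dist x x0 powi m = dist x x0 powi (1 - ?n) * dist x x0"
          using power_int_add_1[of "dist x x0" "m - 1"] pos by (simp flip: m1)
        then show ?thesis
          using pos True unfolding momentum_current_radial[OF lin] Q_def f
          by (simp add: field_simps power2_eq_square)
      qed simp
    qed
    also have "\<dots> = I - mu / 2 * J"
      using intI intJ by (simp add: I_def J_def)
    finally show ?thesis .
  qed
  \<comment> \<open>integration by parts in the radius\<close>
  have layers: "of_int m * b = R2 powi m * G R2 - R1 powi m * G R1 - J"
  proof -
    let ?B = "\<lambda>r x. indicator (ball x0 r) x *\<^sub>R Q x"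
    have intB: "integrable lborel (?B r)" for r
    proof -
      have "integrable lborel (\<lambda>x. indicator (ball x0 r) x *\<^sub>R (indicator (cball x0 r) x *\<^sub>R Q x))"
        by (intro integrable_mult_indicator borel_integrable_compact cQ) auto
      moreover have "indicator (ball x0 r) x *\<^sub>R (indicator (cball x0 r) x *\<^sub>R Q x) = ?B r x" for x
        by (auto simp: indicator_def)
      ultimately show ?thesis by (simp only:)
    qed
    have "of_int m * b = (LINT r:{R1..R2}|lborel. (of_int m * r powi (1 - ?n)) * (LINT x:ball x0 r|lborel. Q x))"
      unfolding b_def by (simp add: mult.assoc)
    also have "\<dots> = (\<integral> x. radial_cutoff (\<lambda>s. s powi m) R1 R2 x0 x * Q x \<partial>lborel)"
      by (rule pow.integral_radial_cutoff[OF cQ, symmetric])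
    also have "\<dots> = (\<integral> x. R2 powi m * ?B R2 x - R1 powi m * ?B R1 x - ?A x * (dist x x0 powi m * Q x) \<partial>lborel)"
    proof (rule integral_cong_AE)
      show "AE x in lborel. radial_cutoff (\<lambda>s. s powi m) R1 R2 x0 x * Q x
          = R2 powi m * ?B R2 x - R1 powi m * ?B R1 x - ?A x * (dist x x0 powi m * Q x)"
        using AE_lborel_dist_neq[of x0 R2]
      proof eventually_elim
        case (elim x)
        then consider "dist x x0 < R1" | "R1 \<le> dist x x0" "dist x x0 < R2" | "R2 < dist x x0"
          by linarith
        then show ?case
          using \<open>R1 < R2\<close> by cases (auto simp: radial_cutoff_def dist_commute algebra_simps)
      qed
      show "(\<lambda>x. radial_cutoff (\<lambda>s. s powi m) R1 R2 x0 x * Q x) \<in> borel_measurable lborel"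
        using pow.integrable_radial_cutoff[OF cQ] by (rule borel_measurable_integrable)
      show "(\<lambda>x. R2 powi m * ?B R2 x - R1 powi m * ?B R1 x - ?A x * (dist x x0 powi m * Q x)) \<in> borel_measurable lborel"
        using intB intJ by (intro borel_measurable_integrable) auto
    qed
    also have "\<dots> = R2 powi m * G R2 - R1 powi m * G R1 - J"
      using intB intJ by (simp add: G_def J_def set_lebesgue_integral_def)
    finally show ?thesis .
  qed
  have "R2 powi m * mu * G R2 - R1 powi m * mu * G R1 = mu * (of_int m * b + J)"
    unfolding layers by (simp add: algebra_simps)
  also have "\<dots> = - 2 * lam * a + 2 * I"
    using balance by (simp add: m_def algebra_simps)
  finally show ?thesis
    unfolding polar unfolding m_def G_def a_def Q_def N_def f_def .
qed

end
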